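(* Given a twisted cubic and three general points in $\mathbb{P}^3$, they lie on a quadric surface if and only if the twisted cubic meets the plane spanned by the three given points in three additional points which, together with the three given points, lie on a conic in that plane.
   Context: $\mathbb{P}^3$ is projective 3-space. A quadric surface is a surface in $\mathbb{P}^3$ defined by a nonzero homogeneous quadratic polynomial. A twisted cubic is a rational normal curve of degree 3 in $\mathbb{P}^3$. A conic in a plane is a curve of degree 2 in that plane. *)

theory Defs
  imports "HOL-Analysis.Analysis"
begin

text \<open>
  Projective space over a field is the set of one-dimensional linear subspaces; a point of
  $P^3$ is thus a subset of \<open>'a^4\<close>, and \<open>proj W\<close> is the linear subvariety attached to a
  subspace \<open>W\<close>.
\<close>

definition proj :: "(('a::field)^'n) set \<Rightarrow> ('a^'n) set set" where
  "proj W = {vec.span {v} | v. v \<in> W \<and> v \<noteq> 0}"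

abbreviation proj_space :: "(('a::field)^'n) set set" where
  "proj_space \<equiv> proj UNIV"

definition plane_through ::
  "(('a::field)^4) set \<Rightarrow> ('a^4) set \<Rightarrow> ('a^4) set \<Rightarrow> ('a^4) set set" where
  "plane_through p q r = proj (vec.span (p \<union> q \<union> r))"

text \<open>
  The homogeneous quadratic polynomial with coefficient \<open>c i j\<close> at the monomial $x_i x_j$,
  \<open>i \<le> j\<close>. Using only these monomials (rather than a symmetric matrix) keeps the notion
  correct in characteristic 2. The values \<open>c i j\<close> with \<open>j < i\<close> are irrelevant.
\<close>

definition quad_poly :: "('n \<Rightarrow> 'n \<Rightarrow> 'a) \<Rightarrow> ('a::field)^('n::{finite,linorder}) \<Rightarrow> 'a" where
  "quad_poly c x = (\<Sum>(i,j)\<in>{(i,j). i \<le> j}. c i j * x $ i * x $ j)"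

definition is_quadric :: "(('a::field)^('n::{finite,linorder})) set set \<Rightarrow> bool" where
  "is_quadric Q \<longleftrightarrow>
    (\<exists>c. (\<exists>i j. i \<le> j \<and> c i j \<noteq> 0) \<and>
         Q = {p \<in> proj_space. \<forall>x\<in>p. quad_poly c x = 0})"

abbreviation quadric_surface :: "(('a::field)^4) set set \<Rightarrow> bool" where
  "quadric_surface Q \<equiv> is_quadric Q"

text \<open>
  A conic in a plane \<open>H\<close> of $P^3$ is the image of a conic of $P^2$ (possibly reducible or
  a double line) under a linear isomorphism from $P^2$ onto \<open>H\<close>.
\<close>

definition conic_in_plane :: "(('a::field)^4) set set \<Rightarrow> ('a^4) set set \<Rightarrow> bool" where
  "conic_in_plane H K \<longleftrightarrow>
    (\<exists>(M :: 'a^3^4) (D :: ('a^3) set set).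
       inj ((*v) M) \<and> H = proj (range ((*v) M)) \<and>
       is_quadric D \<and> K = (\<lambda>p. (*v) M ` p) ` D)"

text \<open>
  A rational normal curve of degree 3 is the image of $P^1$ under a basis of the binary cubic
  forms, i.e. under the Veronese map followed by an invertible linear map.
\<close>

definition veronese3 :: "'a::field \<Rightarrow> 'a \<Rightarrow> 'a^4" where
  "veronese3 s t = vector [s^3, s^2 * t, s * t^2, t^3]"

definition cubic_curve :: "('a::field)^4^4 \<Rightarrow> ('a^4) set set" where
  "cubic_curve A = {vec.span {A *v veronese3 s t} | s t. (s, t) \<noteq> (0, 0)}"

definition twisted_cubic :: "(('a::field)^4) set set \<Rightarrow> bool" where
  "twisted_cubic C \<longleftrightarrow> (\<exists>A. invertible A \<and> C = cubic_curve A)"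

text \<open>
  The tangent line at the point with parameter $[s:t]$ is spanned by that point and the two
  partial derivatives. The point itself is listed because in characteristic 3 it need not be
  in the span of the partial derivatives.
\<close>

definition tangent_line :: "('a::field)^4^4 \<Rightarrow> 'a \<Rightarrow> 'a \<Rightarrow> ('a^4) set set" where
  "tangent_line A s t = proj (vec.span ((*v) A `
     {veronese3 s t,
      vector [3 * s^2, 2 * s * t, t^2, 0],
      vector [0, s^2, 2 * s * t, 3 * t^2]}))"

definition plane_tangent_to :: "(('a::field)^4) set set \<Rightarrow> ('a^4) set set \<Rightarrow> bool" where
  "plane_tangent_to H C \<longleftrightarrow>
    (\<exists>A s t. invertible A \<and> C = cubic_curve A \<and> (s, t) \<noteq> (0, 0) \<and> tangent_line A s t \<subseteq> H)"

text \<open>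
  The general position required of three points: they span a plane, this plane is nowhere
  tangent to the curve, and none of the points is on the curve. A bare existential
  ``for some nonempty Zariski open set of triples'' would not do: for a general triple there
  is no quadric at all, so such a claim would be satisfied by removing the triples of interest.
\<close>

definition general_triple ::
  "(('a::field)^4) set set \<Rightarrow> ('a^4) set \<Rightarrow> ('a^4) set \<Rightarrow> ('a^4) set \<Rightarrow> bool" where
  "general_triple C p q r \<longleftrightarrow>
    p \<in> proj_space \<and> q \<in> proj_space \<and> r \<in> proj_space \<and>
    vec.dim (p \<union> q \<union> r) = 3 \<and>
    \<not> plane_tangent_to (plane_through p q r) C \<and>
    p \<notin> C \<and> q \<notin> C \<and> r \<notin> C"

text \<open>
  Zariski topology on $P^3 \times P^3 \times P^3$. Over an infinite field a polynomial
  vanishes on a product of three lines iff all its multihomogeneous components do, so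
  multihomogeneity need not be demanded of the defining polynomials.
\<close>

inductive poly_function3 :: "(('a::field)^4 \<Rightarrow> 'a^4 \<Rightarrow> 'a^4 \<Rightarrow> 'a) \<Rightarrow> bool" where
  "poly_function3 (\<lambda>x y z. c)"
| "poly_function3 (\<lambda>x y z. x $ i)"
| "poly_function3 (\<lambda>x y z. y $ i)"
| "poly_function3 (\<lambda>x y z. z $ i)"
| "poly_function3 F \<Longrightarrow> poly_function3 G \<Longrightarrow> poly_function3 (\<lambda>x y z. F x y z + G x y z)"
| "poly_function3 F \<Longrightarrow> poly_function3 G \<Longrightarrow> poly_function3 (\<lambda>x y z. F x y z * G x y z)"

definition zariski_closed3 ::
  "((('a::field)^4) set \<times> ('a^4) set \<times> ('a^4) set) set \<Rightarrow> bool" where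
  "zariski_closed3 Z \<longleftrightarrow>
    (\<exists>S. (\<forall>F\<in>S. poly_function3 F) \<and>
         Z = {(p, q, r). p \<in> proj_space \<and> q \<in> proj_space \<and> r \<in> proj_space \<and>
                (\<forall>F\<in>S. \<forall>x\<in>p. \<forall>y\<in>q. \<forall>z\<in>r. F x y z = 0)})"

definition zariski_open3 ::
  "((('a::field)^4) set \<times> ('a^4) set \<times> ('a^4) set) set \<Rightarrow> bool" where
  "zariski_open3 U \<longleftrightarrow>
    U \<subseteq> proj_space \<times> proj_space \<times> proj_space \<and>
    zariski_closed3 (proj_space \<times> proj_space \<times> proj_space - U)"

end

theory Submission
  imports Defs
begin

text \<open>
  Let \<open>A\<close> parametrize the curve and let \<open>h\<close> be the equation of the plane through the three
  points in the coordinates given by \<open>A\<close>. The plane meets the curve at the zeros of the binary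
  cubic with coefficients \<open>h\<close>, and it is tangent to the curve iff the discriminant of this cubic
  vanishes. The discriminant and the 2x2 minors defining the curve are polynomials, hence general
  triples form an open set. For a general triple let \<open>P\<^sub>1, P\<^sub>2, P\<^sub>3\<close> be the three zeros; the
  corresponding points of the curve are a basis of the plane. In this basis a quadric of the net
  spanned by the minors restricts to a conic through the basis points, and the restriction is a
  bijection from the net onto these conics: up to the nonzero factors \<open>[P\<^sub>i, P\<^sub>j]\<^sup>2\<close> it sends a
  symmetric bilinear form on the plane of parameters to its values at the three pairs
  \<open>P\<^sub>i, P\<^sub>j\<close>. So the quadrics through the curve and \<open>p\<close>, \<open>q\<close>, \<open>r\<close> correspond to the
  conics through all six points.
\<close>

subsection \<open>Binary cubic forms\<close>

lemma vector_4:
  "(vector [x, y, z, w] :: 'a::zero^4)$1 = x"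
  "(vector [x, y, z, w] :: 'a::zero^4)$2 = y"
  "(vector [x, y, z, w] :: 'a::zero^4)$3 = z"
  "(vector [x, y, z, w] :: 'a::zero^4)$4 = w"
  unfolding vector_def by simp_all

text \<open>Over a finite field, the product of all \<open>x - a\<close> plus 1 would be a
  nonconstant polynomial without roots.\<close>

lemma infinite_UNIV_alg_closed: "infinite (UNIV :: 'a::alg_closed_field set)"
proof
  assume fin: "finite (UNIV :: 'a set)"
  define q :: "'a poly" where "q = (\<Prod>a\<in>UNIV. [:- a, 1:])"
  have deg: "degree q = card (UNIV :: 'a set)"
    unfolding q_def by (subst degree_prod_eq_sum_degree) auto
  have "degree (q + 1) = degree q"
    using deg fin by (intro degree_add_eq_left) (simp add: card_gt_0_iff)
  hence "degree (q + 1) > 0"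
    using deg fin by (simp add: card_gt_0_iff)
  then obtain z where "poly (q + 1) z = 0"
    using alg_closed_imp_poly_has_root by blast
  moreover have "poly q z = 0"
    unfolding q_def poly_prod using fin by (intro prod_zero) auto
  ultimately show False by simp
qed

lemma poly_zero_on_UNIV_imp_zero:
  fixes p :: "'a::alg_closed_field poly"
  assumes "\<And>x. poly p x = 0"
  shows "p = 0"
  using poly_roots_finite[of p] infinite_UNIV_alg_closed assms by auto

text \<open>The linear form with coefficients \<open>h\<close> pulled back along
  \<open>veronese3\<close>. There are no binomial factors, so every binary cubic arises in
  characteristics 2 and 3 too.\<close>

definition cubic_form :: "'a::field^4 \<Rightarrow> 'a \<Rightarrow> 'a \<Rightarrow> 'a" where
  "cubic_form h s t = h$1 * s^3 + h$2 * s^2 * t + h$3 * s * t^2 + h$4 * t^3"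

definition cubic_disc :: "'a::field^4 \<Rightarrow> 'a" where
  "cubic_disc h = (h$2)^2 * (h$3)^2 - 4 * h$1 * (h$3)^3 - 4 * (h$2)^3 * h$4
     + 18 * h$1 * h$2 * h$3 * h$4 - 27 * (h$1)^2 * (h$4)^2"

text \<open>Coefficients of a product of three binary linear forms \<open>p * s + q * t\<close>.
  Working with factors instead of roots treats the zero \<open>[1:0]\<close> like any other.\<close>

definition cubic_prod :: "'a::field \<Rightarrow> 'a \<Rightarrow> 'a \<Rightarrow> 'a \<Rightarrow> 'a \<Rightarrow> 'a \<Rightarrow> 'a^4" where
  "cubic_prod p1 q1 p2 q2 p3 q3 = vector [p1 * p2 * p3,
     q1 * p2 * p3 + p1 * q2 * p3 + p1 * p2 * q3,
     p1 * q2 * q3 + q1 * p2 * q3 + q1 * q2 * p3,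
     q1 * q2 * q3]"

lemma cubic_form_cubic_prod:
  "cubic_form (cubic_prod p1 q1 p2 q2 p3 q3) s t
     = (p1 * s + q1 * t) * (p2 * s + q2 * t) * (p3 * s + q3 * t)"
  unfolding cubic_form_def cubic_prod_def vector_4 by algebra

text \<open>The brackets on the right compare the linear factors in pairs, so the discriminant
  vanishes exactly when two factors are proportional.\<close>

lemma cubic_disc_cubic_prod:
  "cubic_disc (cubic_prod p1 q1 p2 q2 p3 q3)
     = (p1 * q2 - p2 * q1)^2 * (p1 * q3 - p3 * q1)^2 * (p2 * q3 - p3 * q2)^2"
  unfolding cubic_disc_def cubic_prod_def vector_4 by algebra

lemma alg_closed_quadratic_splits:
  fixes a b c :: "'a::alg_closed_field"
  obtains p1 q1 p2 q2 where "a = p1 * p2" "b = p1 * q2 + q1 * p2" "c = q1 * q2"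
proof (cases "a = 0")
  case True
  \<comment> \<open>Without an \<open>s^2\<close> term the form is
    \<open>t * (b * s + c * t)\<close>.\<close>
  show ?thesis by (rule that[where ?p1.0 = 0 and ?q1.0 = 1 and ?p2.0 = b and ?q2.0 = c])
    (use True in auto)
next
  case False
  have "degree [:c, b, a:] > 0" using False by simp
  then obtain r where "poly [:c, b, a:] r = 0"
    using alg_closed_imp_poly_has_root by blast
  hence r: "c = - r * (b + a * r)" by (simp add: algebra_simps eq_neg_iff_add_eq_0)
  \<comment> \<open>A root \<open>r\<close> splits off the factor \<open>s - r * t\<close>.\<close>
  show ?thesis by (rule that[where ?p1.0 = 1 and ?q1.0 = "- r" and ?p2.0 = a and ?q2.0 = "b + a * r"])
    (use r in \<open>auto simp: algebra_simps\<close>)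
qed

lemma cubic_splits:
  fixes h :: "'a::alg_closed_field^4"
  obtains p1 q1 p2 q2 p3 q3 where "h = cubic_prod p1 q1 p2 q2 p3 q3"
proof (cases "h$1 = 0")
  case True
  obtain p1 q1 p2 q2 where
    "h$2 = p1 * p2" "h$3 = p1 * q2 + q1 * p2" "h$4 = q1 * q2"
    by (rule alg_closed_quadratic_splits)
  with True show ?thesis
    by (intro that[of 0 1 p1 q1 p2 q2]) (simp add: cubic_prod_def vector_4 vec_eq_iff forall_4)
next
  case False
  have "degree [:h$4, h$3, h$2, h$1:] > 0" using False by simp
  then obtain r where "poly [:h$4, h$3, h$2, h$1:] r = 0"
    using alg_closed_imp_poly_has_root by blast
  hence r: "h$4 = - r * (h$3 + r * (h$2 + r * h$1))" by (simp add: eq_neg_iff_add_eq_0)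
  \<comment> \<open>These are the coefficients of the quotient of the cubic by
    \<open>s - r * t\<close>, computed by Horner's scheme.\<close>
  obtain p1 q1 p2 q2 where *: "h$1 = p1 * p2" "h$2 + r * h$1 = p1 * q2 + q1 * p2"
      "h$3 + r * (h$2 + r * h$1) = q1 * q2"
    by (rule alg_closed_quadratic_splits)
  have "h$2 = p1 * q2 + q1 * p2 - r * (p1 * p2)" "h$3 = q1 * q2 - r * (p1 * q2 + q1 * p2)"
    "h$4 = - r * (q1 * q2)"
    using * r by (simp_all add: algebra_simps)
  with * show ?thesis
    by (intro that[of 1 "- r" p1 q1 p2 q2])
       (simp add: cubic_prod_def vector_4 vec_eq_iff forall_4 algebra_simps)
qed

text \<open>Equality of points \<open>[s:t]\<close> of the projective line is written here and below
  as the vanishing of a 2x2 determinant, which avoids division. Eliminating between the two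
  equations shows that \<open>p\<close> and \<open>q\<close> both annihilate it.\<close>

lemma linear_form_common_zero:
  fixes p q :: "'a::field"
  assumes "p * s + q * t = 0" "p * s' + q * t' = 0" "(p, q) \<noteq> (0, 0)"
  shows "s * t' = s' * t"
proof -
  have "p * (s * t' - s' * t) = 0" "q * (s * t' - s' * t) = 0"
    using assms(1,2) by algebra+
  thus ?thesis using assms(3) by auto
qed

lemma cubic_prod_nonzeroD:
  assumes "cubic_prod p1 q1 p2 q2 p3 q3 \<noteq> 0"
  shows "(p1, q1) \<noteq> (0, 0)" "(p2, q2) \<noteq> (0, 0)" "(p3, q3) \<noteq> (0, 0)"
  using assms by (auto simp: cubic_prod_def vector_4 vec_eq_iff forall_4)

text \<open>If two of the three linear factors are proportional, there are at most two zeros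
  \<open>[s:t]\<close>.\<close>

lemma cubic_prod_repeated_factor:
  fixes p1 :: "'a::field"
  assumes h: "cubic_prod p1 q1 p2 q2 p3 q3 \<noteq> 0" and D: "p1 * q2 = p2 * q1"
    and z: "\<And>s t. (s, t) \<in> {(s1, t1), (s2, t2), (s3, t3)} \<Longrightarrow>
        (p1 * s + q1 * t) * (p2 * s + q2 * t) * (p3 * s + q3 * t) = 0"
  shows "s1 * t2 = s2 * t1 \<or> s1 * t3 = s3 * t1 \<or> s2 * t3 = s3 * t2"
proof -
  note nz = cubic_prod_nonzeroD[OF h]
  have "p1 * s + q1 * t = 0" if "p2 * s + q2 * t = 0" for s t
  proof -
    have "p2 * (p1 * s + q1 * t) = 0" "q2 * (p1 * s + q1 * t) = 0"
      using that D by algebra+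
    thus ?thesis using nz(2) by auto
  qed
  hence "p1 * s + q1 * t = 0 \<or> p3 * s + q3 * t = 0"
    if "(s, t) \<in> {(s1, t1), (s2, t2), (s3, t3)}" for s t
    using z[OF that] by auto
  \<comment> \<open>Three parameters are zeros of only two nonzero linear forms, so two of them
    share a form.\<close>
  hence "p1 * s1 + q1 * t1 = 0 \<or> p3 * s1 + q3 * t1 = 0"
    "p1 * s2 + q1 * t2 = 0 \<or> p3 * s2 + q3 * t2 = 0"
    "p1 * s3 + q1 * t3 = 0 \<or> p3 * s3 + q3 * t3 = 0"
    by auto
  thus ?thesis
    using linear_form_common_zero[OF _ _ nz(1)] linear_form_common_zero[OF _ _ nz(3)] by metis
qed

lemma cubic_disc_nonzero_if_three_zeros:
  fixes h :: "'a::alg_closed_field^4"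
  assumes h: "h \<noteq> 0"
    and z: "cubic_form h s1 t1 = 0" "cubic_form h s2 t2 = 0" "cubic_form h s3 t3 = 0"
    and d: "s1 * t2 \<noteq> s2 * t1" "s1 * t3 \<noteq> s3 * t1" "s2 * t3 \<noteq> s3 * t2"
  shows "cubic_disc h \<noteq> 0"
proof
  assume "cubic_disc h = 0"
  obtain p1 q1 p2 q2 p3 q3 where hp: "h = cubic_prod p1 q1 p2 q2 p3 q3"
    by (rule cubic_splits)
  have "p1 * q2 = p2 * q1 \<or> p1 * q3 = p3 * q1 \<or> p2 * q3 = p3 * q2"
    using \<open>cubic_disc h = 0\<close> by (simp add: hp cubic_disc_cubic_prod)
  \<comment> \<open>Reordering the factors brings any of the three possibly proportional pairs to
    the front.\<close>
  moreover have perm: "cubic_prod p1 q1 p3 q3 p2 q2 = h" "cubic_prod p2 q2 p3 q3 p1 q1 = h"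
    by (simp_all add: hp cubic_prod_def vector_4 vec_eq_iff forall_4 algebra_simps)
  moreover have "cubic_form h s t = 0" if "(s, t) \<in> {(s1, t1), (s2, t2), (s3, t3)}" for s t
    using that z by auto
  ultimately show False
    using cubic_prod_repeated_factor[of p1 q1 p2 q2 p3 q3 s1 t1 s2 t2 s3 t3]
      cubic_prod_repeated_factor[of p1 q1 p3 q3 p2 q2 s1 t1 s2 t2 s3 t3]
      cubic_prod_repeated_factor[of p2 q2 p3 q3 p1 q1 s1 t1 s2 t2 s3 t3] d h hp
      cubic_form_cubic_prod[of p1 q1 p2 q2 p3 q3]
      cubic_form_cubic_prod[of p1 q1 p3 q3 p2 q2]
      cubic_form_cubic_prod[of p2 q2 p3 q3 p1 q1]
    by metis
qed

lemma cubic_three_zeros: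
  fixes h :: "'a::alg_closed_field^4"
  assumes "cubic_disc h \<noteq> 0"
  obtains s1 t1 s2 t2 s3 t3 where
    "s1 * t2 \<noteq> s2 * t1" "s1 * t3 \<noteq> s3 * t1" "s2 * t3 \<noteq> s3 * t2"
    "\<And>s t. cubic_form h s t = 0 \<longleftrightarrow> s * t1 = s1 * t \<or> s * t2 = s2 * t \<or> s * t3 = s3 * t"
proof -
  obtain p1 q1 p2 q2 p3 q3 where hp: "h = cubic_prod p1 q1 p2 q2 p3 q3"
    by (rule cubic_splits)
  have "p1 * q2 \<noteq> p2 * q1" "p1 * q3 \<noteq> p3 * q1" "p2 * q3 \<noteq> p3 * q2"
    using assms by (auto simp: hp cubic_disc_cubic_prod)
  \<comment> \<open>The factor \<open>p * s + q * t\<close> has its zero at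
    \<open>[q : -p]\<close>.\<close>
  moreover have "cubic_form h s t = 0 \<longleftrightarrow>
      s * (-p1) = q1 * t \<or> s * (-p2) = q2 * t \<or> s * (-p3) = q3 * t" for s t
    unfolding hp cubic_form_cubic_prod
    by (simp add: eq_neg_iff_add_eq_0 mult.commute[of s] neg_eq_iff_add_eq_0)
  ultimately show ?thesis
    by (intro that[where ?s1.0 = q1 and ?t1.0 = "-p1" and ?s2.0 = q2 and ?t2.0 = "-p2"
          and ?s3.0 = q3 and ?t3.0 = "-p3"])
       (auto simp: algebra_simps)
qed

text \<open>This and the next definition are the formal partial derivatives of
  \<open>cubic_form\<close>, arranged as the pairing of \<open>h\<close> with the derivative vectors
  in \<open>tangent_line\<close>.\<close>

definition cubic_form_ds :: "'a::field^4 \<Rightarrow> 'a \<Rightarrow> 'a \<Rightarrow> 'a" where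
  "cubic_form_ds h s t = h$1 * (3 * s^2) + h$2 * (2 * s * t) + h$3 * t^2"

definition cubic_form_dt :: "'a::field^4 \<Rightarrow> 'a \<Rightarrow> 'a \<Rightarrow> 'a" where
  "cubic_form_dt h s t = h$2 * s^2 + h$3 * (2 * s * t) + h$4 * (3 * t^2)"

lemma cubic_form_d_cubic_prod:
  "cubic_form_ds (cubic_prod p1 q1 p2 q2 p3 q3) s t =
     p1 * (p2 * s + q2 * t) * (p3 * s + q3 * t) + (p1 * s + q1 * t) * p2 * (p3 * s + q3 * t)
     + (p1 * s + q1 * t) * (p2 * s + q2 * t) * p3"
  "cubic_form_dt (cubic_prod p1 q1 p2 q2 p3 q3) s t =
     q1 * (p2 * s + q2 * t) * (p3 * s + q3 * t) + (p1 * s + q1 * t) * q2 * (p3 * s + q3 * t)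
     + (p1 * s + q1 * t) * (p2 * s + q2 * t) * q3"
  unfolding cubic_form_ds_def cubic_form_dt_def cubic_prod_def vector_4 by algebra+

text \<open>By the product rule, at a zero of one linear factor both derivatives are the
  coefficients of that factor times the product of the other two. So they vanish there exactly when
  a second factor does. In characteristic 3 Euler's relation does not recover the value of the form
  from its derivatives, hence the separate condition on the form.\<close>

lemma cubic_disc_eq_0_iff:
  fixes h :: "'a::alg_closed_field^4"
  assumes h: "h \<noteq> 0"
  shows "cubic_disc h = 0 \<longleftrightarrow> (\<exists>s t. (s, t) \<noteq> (0, 0) \<and>
      cubic_form h s t = 0 \<and> cubic_form_ds h s t = 0 \<and> cubic_form_dt h s t = 0)"
proof
  obtain p1 q1 p2 q2 p3 q3 where hp: "h = cubic_prod p1 q1 p2 q2 p3 q3"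
    by (rule cubic_splits)
  note nz = cubic_prod_nonzeroD[OF h[unfolded hp]]
  note fs = hp cubic_form_cubic_prod cubic_form_d_cubic_prod
  {
    assume "cubic_disc h = 0"
    then consider "p1 * q2 = p2 * q1" | "p1 * q3 = p3 * q1" | "p2 * q3 = p3 * q2"
      by (auto simp: hp cubic_disc_cubic_prod)
    thus "\<exists>s t. (s, t) \<noteq> (0, 0) \<and>
      cubic_form h s t = 0 \<and> cubic_form_ds h s t = 0 \<and> cubic_form_dt h s t = 0"
    proof cases
      case 1
      \<comment> \<open>The zero \<open>[q1 : -p1]\<close> of the first factor is also a zero of the
        second, by proportionality.\<close>
      have "p1 * q1 + q1 * - p1 = 0" "p2 * q1 + q2 * - p1 = 0"
        using 1 by (simp_all add: algebra_simps)
      hence "(q1, - p1) \<noteq> (0, 0) \<and> cubic_form h q1 (- p1) = 0 \<and>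
          cubic_form_ds h q1 (- p1) = 0 \<and> cubic_form_dt h q1 (- p1) = 0"
        using nz(1) by (auto simp: fs)
      thus ?thesis by blast
    next
      case 2
      have "p1 * q1 + q1 * - p1 = 0" "p3 * q1 + q3 * - p1 = 0"
        using 2 by (simp_all add: algebra_simps)
      hence "(q1, - p1) \<noteq> (0, 0) \<and> cubic_form h q1 (- p1) = 0 \<and>
          cubic_form_ds h q1 (- p1) = 0 \<and> cubic_form_dt h q1 (- p1) = 0"
        using nz(1) by (auto simp: fs)
      thus ?thesis by blast
    next
      case 3
      have "p2 * q2 + q2 * - p2 = 0" "p3 * q2 + q3 * - p2 = 0"
        using 3 by (simp_all add: algebra_simps)
      hence "(q2, - p2) \<noteq> (0, 0) \<and> cubic_form h q2 (- p2) = 0 \<and>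
          cubic_form_ds h q2 (- p2) = 0 \<and> cubic_form_dt h q2 (- p2) = 0"
        using nz(2) by (auto simp: fs)
      thus ?thesis by blast
    qed
  }
  assume "\<exists>s t. (s, t) \<noteq> (0, 0) \<and>
      cubic_form h s t = 0 \<and> cubic_form_ds h s t = 0 \<and> cubic_form_dt h s t = 0"
  then obtain s t where st: "(s, t) \<noteq> (0, 0)" and
    z: "cubic_form h s t = 0" "cubic_form_ds h s t = 0" "cubic_form_dt h s t = 0" by blast
  let ?L = "\<lambda>p q. p * s + q * t"
  \<comment> \<open>Coefficients and variables exchange roles: two forms with a common zero are
    proportional.\<close>
  have two: "p * q' = p' * q" if "?L p q = 0" "?L p' q' = 0" for p q p' q'
    using linear_form_common_zero[of s p t q p' q'] that st by (simp add: mult.commute)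
  consider "?L p1 q1 = 0" | "?L p2 q2 = 0" | "?L p3 q3 = 0"
    using z(1) by (auto simp: fs)
  hence "p1 * q2 = p2 * q1 \<or> p1 * q3 = p3 * q1 \<or> p2 * q3 = p3 * q2"
  proof cases
    case 1
    hence "?L p2 q2 = 0 \<or> ?L p3 q3 = 0" using z(2,3) nz(1) by (auto simp: fs)
    thus ?thesis using two 1 by metis
  next
    case 2
    hence "?L p1 q1 = 0 \<or> ?L p3 q3 = 0" using z(2,3) nz(2) by (auto simp: fs)
    thus ?thesis using two 2 by metis
  next
    case 3
    hence "?L p1 q1 = 0 \<or> ?L p2 q2 = 0" using z(2,3) nz(3) by (auto simp: fs)
    thus ?thesis using two 3 by metis
  qed
  thus "cubic_disc h = 0" by (auto simp: hp cubic_disc_cubic_prod)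
qed

subsection \<open>Planes and the twisted cubic\<close>

lemma span_singleton_eq_iff:
  fixes u v :: "'a::field^'n"
  assumes "u \<noteq> 0"
  shows "vec.span {u} = vec.span {v} \<longleftrightarrow> (\<exists>c. c \<noteq> 0 \<and> u = c *s v)"
proof
  assume eq: "vec.span {u} = vec.span {v}"
  have "u \<in> vec.span {v}" using eq vec.span_base[of u "{u}"] by simp
  then obtain c where "u = c *s v" by (auto simp: vec.span_singleton)
  with assms show "\<exists>c. c \<noteq> 0 \<and> u = c *s v" by (intro exI[of _ c]) auto
next
  assume "\<exists>c. c \<noteq> 0 \<and> u = c *s v"
  then obtain c where c: "c \<noteq> 0" "u = c *s v" by blast
  have "v = inverse c *s u" using c by simp
  hence "v \<in> vec.span {u}" by (auto simp: vec.span_singleton)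
  moreover have "u \<in> vec.span {v}" using c by (auto simp: vec.span_singleton)
  ultimately show "vec.span {u} = vec.span {v}"
    by (intro subset_antisym vec.span_minimal) auto
qed

lemma proj_spaceE:
  assumes "p \<in> proj_space"
  obtains x where "x \<noteq> 0" "p = vec.span {x}"
  using assms by (auto simp: proj_def)

lemma proj_space_span_singleton_iff [simp]: "vec.span {x} \<in> proj_space \<longleftrightarrow> x \<noteq> 0"
proof
  assume "vec.span {x} \<in> proj_space"
  then obtain y where "y \<noteq> 0" "vec.span {y} = vec.span {x}" by (metis proj_spaceE)
  thus "x \<noteq> 0" by (auto simp: span_singleton_eq_iff)
qed (auto simp: proj_def)

lemma span_singleton_mem_proj_iff:
  assumes "vec.subspace W" "v \<noteq> 0"
  shows "vec.span {v} \<in> proj W \<longleftrightarrow> v \<in> W"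
proof
  assume "vec.span {v} \<in> proj W"
  then obtain u where u: "vec.span {v} = vec.span {u}" "u \<in> W" by (auto simp: proj_def)
  then obtain c where "v = c *s u" using span_singleton_eq_iff assms(2) by blast
  thus "v \<in> W" using u assms(1) by (simp add: vec.subspace_scale)
qed (use assms in \<open>auto simp: proj_def\<close>)

lemma proj_span_subset_iff:
  assumes "vec.subspace W"
  shows "proj (vec.span S) \<subseteq> proj W \<longleftrightarrow> S \<subseteq> W"
proof
  assume sub: "proj (vec.span S) \<subseteq> proj W"
  show "S \<subseteq> W"
  proof
    fix v assume "v \<in> S"
    show "v \<in> W"
    proof (cases "v = 0")
      case True thus ?thesis using assms by (simp add: vec.subspace_0)
    next
      case False
      hence "vec.span {v} \<in> proj (vec.span S)"
        using \<open>v \<in> S\<close> by (simp add: span_singleton_mem_proj_iff vec.span_base)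
      thus ?thesis using sub span_singleton_mem_proj_iff[OF assms False] by blast
    qed
  qed
next
  assume "S \<subseteq> W"
  hence "vec.span S \<subseteq> W" using assms by (simp add: vec.span_minimal)
  thus "proj (vec.span S) \<subseteq> proj W" by (auto simp: proj_def)
qed

lemma proj_inject:
  assumes "vec.subspace V" "vec.subspace W" "proj V = proj W"
  shows "V = W"
proof -
  have "proj (vec.span V) \<subseteq> proj W" "proj (vec.span W) \<subseteq> proj V"
    using assms by (simp_all add: vec.span_eq_iff[THEN iffD2])
  thus ?thesis using assms proj_span_subset_iff by blast
qed

lemma span_Un_span_singletons:
  "vec.span (vec.span {x} \<union> vec.span {y} \<union> vec.span {z}) = vec.span {x, y, z}"
proof (intro subset_antisym vec.span_minimal Un_least)
  have "{x, y, z} \<subseteq> vec.span {x} \<union> vec.span {y} \<union> vec.span {z}"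
    using vec.span_superset[of "{x}"] vec.span_superset[of "{y}"] vec.span_superset[of "{z}"]
    by blast
  thus "{x, y, z} \<subseteq> vec.span (vec.span {x} \<union> vec.span {y} \<union> vec.span {z})"
    using vec.span_superset by blast
qed (auto intro: vec.span_base)

lemma plane_through_span_singletons:
  "plane_through (vec.span {x}) (vec.span {y}) (vec.span {z}) = proj (vec.span {x, y, z})"
  by (simp add: plane_through_def span_Un_span_singletons)

lemma dim_Un_span_singletons:
  "vec.dim (vec.span {x} \<union> vec.span {y} \<union> vec.span {z}) = vec.dim {x, y, z}"
  by (metis span_Un_span_singletons vec.dim_span)

section \<open>Equations of planes by determinants\<close>

lemma det_vector_4_nonzero_iff_span:
  fixes w x y z :: "'a::field^4"
  shows "det (vector [w, x, y, z]) \<noteq> 0 \<longleftrightarrow> vec.span {w, x, y, z} = UNIV"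
proof -
  let ?M = "vector [w, x, y, z] :: 'a^4^4"
  have "rows ?M = (\<lambda>i. ?M $ i) ` UNIV"
    by (auto simp: rows_def row_def image_def)
  hence rows: "rows ?M = {w, x, y, z}" by (auto simp: UNIV_4 vector_4)
  show ?thesis
    by (simp only: invertible_det_nz[symmetric] invertible_left_inverse
      matrix_left_invertible_span_rows_gen rows)
qed

text \<open>Three vectors have dimension at most 3 and a fourth adds at most 1, so full dimension
  requires both bounds to be attained.\<close>

lemma det_vector_4_nonzero_iff:
  fixes w x y z :: "'a::field^4"
  shows "det (vector [w, x, y, z]) \<noteq> 0 \<longleftrightarrow> vec.dim {x, y, z} = 3 \<and> w \<notin> vec.span {x, y, z}"
proof -
  have 1: "det (vector [w, x, y, z]) \<noteq> 0 \<longleftrightarrow> vec.dim {w, x, y, z} = 4"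
    by (simp add: det_vector_4_nonzero_iff_span vec.dim_eq_full[symmetric] vec.dimension_def
        card_cart_basis)
  have "vec.dim {x, y, z} \<le> card {x, y, z}"
    by (intro vec.dim_le_card') auto
  also have "\<dots> \<le> 3" by (simp add: card_insert_if)
  finally show ?thesis unfolding 1 by (auto simp: vec.dim_insert[of w])
qed

text \<open>The coefficients of \<open>w \<mapsto> det [A w, x, y, z]\<close>, i.e. of an equation, in the coordinates
  given by \<open>A\<close>, of the plane through \<open>x\<close>, \<open>y\<close>, \<open>z\<close>.\<close>

definition plane_coeffs :: "'a::field^4^4 \<Rightarrow> 'a^4 \<Rightarrow> 'a^4 \<Rightarrow> 'a^4 \<Rightarrow> 'a^4" where
  "plane_coeffs A x y z = (\<chi> i. det (vector [column i A, x, y, z]))"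

lemma plane_coeffs_eq_det:
  fixes A :: "'a::field^4^4"
  shows "(\<Sum>i\<in>UNIV. plane_coeffs A x y z $ i * w $ i) = det (vector [A *v w, x, y, z])"
proof -
  \<comment> \<open>Writes the first row as a case distinction on the row index, the shape in which
    the multilinearity of \<open>det\<close> is stated.\<close>
  have v: "vector [u, x, y, z] = (\<chi> i. if i = 1 then u else (vector [0, x, y, z] :: 'a^4^4) $ i)"
    for u by (simp add: vec_eq_iff[of "vector [u, x, y, z]"] forall_4 vector_4)
  have "det (vector [A *v w, x, y, z]) =
      (\<Sum>j\<in>UNIV. det (vector [w $ j *s column j A, x, y, z]))"
    unfolding matrix_mult_sum[of A w] by (subst (1 2) v, subst det_linear_row_sum) auto
  also have "\<dots> = (\<Sum>j\<in>UNIV. w $ j * det (vector [column j A, x, y, z]))"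
    by (subst (1 2) v, subst det_row_mul) auto
  finally show ?thesis by (simp add: plane_coeffs_def mult.commute)
qed

lemma plane_coeffs_nonzero_iff:
  fixes A :: "'a::field^4^4"
  assumes "invertible A"
  shows "plane_coeffs A x y z \<noteq> 0 \<longleftrightarrow> vec.dim {x, y, z} = 3"
proof
  assume "plane_coeffs A x y z \<noteq> 0"
  then obtain i where "det (vector [column i A, x, y, z]) \<noteq> 0"
    by (auto simp: plane_coeffs_def vec_eq_iff)
  thus "vec.dim {x, y, z} = 3" by (simp add: det_vector_4_nonzero_iff)
next
  assume d: "vec.dim {x, y, z} = 3"
  have "vec.span {x, y, z} \<noteq> UNIV"
    using d vec.dim_eq_full[of "{x, y, z}"] by (simp add: vec.dimension_def card_cart_basis)
  then obtain u where "u \<notin> vec.span {x, y, z}" by blast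
  moreover obtain w where "A *v w = u"
    using assms by (metis invertible_def matrix_vector_mul_assoc matrix_vector_mul_lid)
  ultimately have "det (vector [A *v w, x, y, z]) \<noteq> 0"
    using d by (simp add: det_vector_4_nonzero_iff)
  thus "plane_coeffs A x y z \<noteq> 0" by (auto simp flip: plane_coeffs_eq_det)
qed

lemma mem_span_iff_plane_coeffs:
  fixes A :: "'a::field^4^4"
  assumes "vec.dim {x, y, z} = 3"
  shows "A *v w \<in> vec.span {x, y, z} \<longleftrightarrow> (\<Sum>i\<in>UNIV. plane_coeffs A x y z $ i * w $ i) = 0"
  using assms det_vector_4_nonzero_iff[of "A *v w" x y z] by (auto simp: plane_coeffs_eq_det)

section \<open>Points and tangent lines of the twisted cubic\<close>

lemma sum_veronese3: "(\<Sum>i\<in>UNIV. h $ i * veronese3 s t $ i) = cubic_form h s t"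
  by (simp add: sum_4 veronese3_def vector_4 cubic_form_def mult.assoc)

lemma invertible_mult_eq_0_iff:
  fixes A :: "'a::field^'n^'n"
  assumes "invertible A"
  shows "A *v x = 0 \<longleftrightarrow> x = 0"
  by (metis assms invertible_def matrix_vector_mul_assoc matrix_vector_mul_lid
      matrix_vector_mult_0_right)

lemma veronese3_eq_0_iff [simp]: "veronese3 s t = 0 \<longleftrightarrow> s = 0 \<and> t = 0"
  by (auto simp: veronese3_def vec_eq_iff forall_4 vector_4)

lemma veronese3_scale: "veronese3 (k * s) (k * t) = k^3 *s veronese3 s t"
  by (simp add: veronese3_def vec_eq_iff forall_4 vector_4 algebra_simps power2_eq_square
      power3_eq_cube)

text \<open>The parametrization is injective on the projective line, so distinctness of points of
  the curve can be checked on parameters.\<close>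

lemma cubic_curve_point_eq_iff:
  fixes A :: "'a::field^4^4"
  assumes A: "invertible A" and nz: "(s, t) \<noteq> (0, 0)" "(s', t') \<noteq> (0, 0)"
  shows "vec.span {A *v veronese3 s t} = vec.span {A *v veronese3 s' t'} \<longleftrightarrow> s * t' = s' * t"
proof -
  have inj: "A *v u = c *s (A *v v) \<longleftrightarrow> u = c *s v" for u v c
    using invertible_mult_eq_0_iff[OF A, of "u - c *s v"]
    by (simp add: matrix_vector_mult_diff_distrib vector_scalar_commute)
  have "A *v veronese3 s t \<noteq> 0" using nz by (auto simp: invertible_mult_eq_0_iff[OF A])
  hence "vec.span {A *v veronese3 s t} = vec.span {A *v veronese3 s' t'} \<longleftrightarrow>
      (\<exists>c. c \<noteq> 0 \<and> veronese3 s t = c *s veronese3 s' t')"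
    by (simp add: span_singleton_eq_iff inj)
  also have "\<dots> \<longleftrightarrow> s * t' = s' * t"
  proof
    assume "\<exists>c. c \<noteq> 0 \<and> veronese3 s t = c *s veronese3 s' t'"
    then obtain c where c: "c \<noteq> 0" and
      e: "s^3 = c * s'^3" "s^2 * t = c * (s'^2 * t')" "s * t^2 = c * (s' * t'^2)"
      by (auto simp: veronese3_def vec_eq_iff forall_4 vector_4)
    show "s * t' = s' * t"
    proof (cases "s' = 0")
      case True
      thus ?thesis using e by simp
    next
      case False
      \<comment> \<open>Both products equal \<open>s^3 * t\<close> by the first two
        equations.\<close>
      have "c * s'^2 * (s * t' - s' * t) = 0" using e by algebra
      thus ?thesis using c False by simp
    qed
  next
    assume e: "s * t' = s' * t"
    obtain k where k: "s = k * s'" "t = k * t'"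
    proof (cases "s' = 0")
      case True
      with nz e have "t' \<noteq> 0" "s = 0" by auto
      thus ?thesis using that[of "t / t'"] True by simp
    next
      case False
      thus ?thesis using that[of "s / s'"] e by (simp add: field_simps)
    qed
    have "k \<noteq> 0" using k nz by auto
    thus "\<exists>c. c \<noteq> 0 \<and> veronese3 s t = c *s veronese3 s' t'"
      unfolding k veronese3_scale by (intro exI[of _ "k^3"]) simp
  qed
  finally show ?thesis .
qed

text \<open>The 2x2 minors of the matrix with rows \<open>w$1, w$2, w$3\<close> and
  \<open>w$2, w$3, w$4\<close>.\<close>

definition veronese_quadrics :: "('a::field^4 \<Rightarrow> 'a) set" where
  "veronese_quadrics = {\<lambda>w. w$1 * w$3 - (w$2)^2, \<lambda>w. w$2 * w$4 - (w$3)^2,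
     \<lambda>w. w$1 * w$4 - w$2 * w$3}"

text \<open>Where \<open>w$1\<close> is nonzero, the minors express \<open>w$3\<close> and
  \<open>w$4\<close> through the parameter \<open>w$2 / w$1\<close>. Where it is zero, they force
  \<open>w$2 = w$3 = 0\<close>, which leaves the parameter \<open>[0:1]\<close>.\<close>

lemma span_mem_cubic_curve_iff:
  fixes A :: "'a::field^4^4"
  assumes A: "invertible A" and w: "w \<noteq> 0"
  shows "vec.span {A *v w} \<in> cubic_curve A \<longleftrightarrow> (\<forall>G\<in>veronese_quadrics. G w = 0)"
proof
  assume "vec.span {A *v w} \<in> cubic_curve A"
  then obtain s t where "vec.span {A *v w} = vec.span {A *v veronese3 s t}"
    by (auto simp: cubic_curve_def)
  moreover have "A *v w \<noteq> 0" using A w invertible_mult_eq_0_iff by blast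
  ultimately obtain c where "A *v w = c *s (A *v veronese3 s t)"
    by (auto simp: span_singleton_eq_iff)
  hence "A *v (w - c *s veronese3 s t) = 0"
    by (simp add: matrix_vector_mult_diff_distrib vector_scalar_commute)
  hence "w = c *s veronese3 s t" by (simp add: invertible_mult_eq_0_iff[OF A])
  thus "\<forall>G\<in>veronese_quadrics. G w = 0"
    by (auto simp: veronese_quadrics_def veronese3_def vector_4 power2_eq_square power3_eq_cube)
next
  assume "\<forall>G\<in>veronese_quadrics. G w = 0"
  hence G: "w$1 * w$3 = (w$2)^2" "w$2 * w$4 = (w$3)^2" "w$1 * w$4 = w$2 * w$3"
    by (auto simp: veronese_quadrics_def)
  have "\<exists>s t c. (s, t) \<noteq> (0, 0) \<and> w = c *s veronese3 s t"
  proof (cases "w$1 = 0")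
    case True
    with G have "w = w$4 *s veronese3 0 1"
      by (auto simp: veronese3_def vec_eq_iff forall_4 vector_4)
    thus ?thesis by (intro exI[of _ 0] exI[of _ 1] exI[of _ "w$4"]) auto
  next
    case False
    have 3: "w$3 = (w$2)^2 / w$1" using G False by (simp add: field_simps)
    have "w$4 = w$2 * w$3 / w$1" using G False by (simp add: field_simps)
    hence 4: "w$4 = (w$2)^3 / (w$1)^2"
      using 3 by (simp add: power2_eq_square power3_eq_cube)
    have "w = w$1 *s veronese3 1 (w$2 / w$1)"
      using False 3 4
      by (simp add: veronese3_def vec_eq_iff forall_4 vector_4 power2_eq_square power3_eq_cube)
    moreover have "(1 :: 'a, w$2 / w$1) \<noteq> (0, 0)" using False by simp
    ultimately show ?thesis by blast
  qed
  then obtain s t c where st: "(s, t) \<noteq> (0, 0)" and c: "w = c *s veronese3 s t" by blast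
  have "A *v w \<noteq> 0" using A w invertible_mult_eq_0_iff by blast
  moreover have "c \<noteq> 0" using c w by auto
  ultimately have "vec.span {A *v w} = vec.span {A *v veronese3 s t}"
    unfolding span_singleton_eq_iff[OF \<open>A *v w \<noteq> 0\<close>]
    by (intro exI[of _ c]) (simp add: c vector_scalar_commute)
  thus "vec.span {A *v w} \<in> cubic_curve A" using st by (auto simp: cubic_curve_def)
qed

lemma cubic_curve_point_mem_plane_iff:
  fixes A :: "'a::field^4^4"
  assumes "invertible A" "vec.dim {x, y, z} = 3" "(s, t) \<noteq> (0, 0)"
  shows "vec.span {A *v veronese3 s t} \<in> proj (vec.span {x, y, z}) \<longleftrightarrow>
    cubic_form (plane_coeffs A x y z) s t = 0"
  using assms
  by (subst span_singleton_mem_proj_iff)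
     (auto simp: invertible_mult_eq_0_iff mem_span_iff_plane_coeffs sum_veronese3)

text \<open>Pairing the equation of the plane with the three vectors spanning the tangent line
  yields the cubic and its two derivatives.\<close>

lemma tangent_line_subset_plane_iff:
  fixes A :: "'a::field^4^4"
  assumes "vec.dim {x, y, z} = 3"
  defines "h \<equiv> plane_coeffs A x y z"
  shows "tangent_line A s t \<subseteq> proj (vec.span {x, y, z}) \<longleftrightarrow>
    cubic_form h s t = 0 \<and> cubic_form_ds h s t = 0 \<and> cubic_form_dt h s t = 0"
proof -
  have "(\<Sum>i\<in>UNIV. h $ i * (vector [3 * s^2, 2 * s * t, t^2, 0] :: 'a^4) $ i)
      = cubic_form_ds h s t"
    "(\<Sum>i\<in>UNIV. h $ i * (vector [0, s^2, 2 * s * t, 3 * t^2] :: 'a^4) $ i)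
      = cubic_form_dt h s t"
    by (simp_all add: sum_4 vector_4 cubic_form_ds_def cubic_form_dt_def)
  thus ?thesis
    unfolding tangent_line_def
    by (simp add: proj_span_subset_iff mem_span_iff_plane_coeffs[OF assms(1)] sum_veronese3
        flip: h_def)
qed

text \<open>The notion of a tangent plane ranges over all parametrizations of the curve. It is
  independent of the parametrization because the plane is tangent exactly if it meets the
  curve in fewer than three points.\<close>

lemma plane_tangent_to_iff:
  fixes A :: "'a::alg_closed_field^4^4"
  assumes A: "invertible A" and d: "vec.dim {x, y, z} = 3"
  shows "plane_tangent_to (proj (vec.span {x, y, z})) (cubic_curve A) \<longleftrightarrow>
    cubic_disc (plane_coeffs A x y z) = 0"
proof
  have disc: "(\<exists>s t. (s, t) \<noteq> (0, 0) \<and> tangent_line A' s t \<subseteq> proj (vec.span {x, y, z})) \<longleftrightarrow>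
      cubic_disc (plane_coeffs A' x y z) = 0" if "invertible A'" for A' :: "'a^4^4"
    using that d cubic_disc_eq_0_iff[of "plane_coeffs A' x y z"]
    by (simp add: tangent_line_subset_plane_iff plane_coeffs_nonzero_iff)
  show "plane_tangent_to (proj (vec.span {x, y, z})) (cubic_curve A)"
    if "cubic_disc (plane_coeffs A x y z) = 0"
    using that disc[OF A] A unfolding plane_tangent_to_def by blast
  assume "plane_tangent_to (proj (vec.span {x, y, z})) (cubic_curve A)"
  then obtain A' :: "'a^4^4" where A': "invertible A'" and eq: "cubic_curve A = cubic_curve A'"
    and z': "cubic_disc (plane_coeffs A' x y z) = 0"
    using disc unfolding plane_tangent_to_def by blast
  show "cubic_disc (plane_coeffs A x y z) = 0"
  proof (rule ccontr)
    assume "cubic_disc (plane_coeffs A x y z) \<noteq> 0"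
    then obtain s1 t1 s2 t2 s3 t3 where
      ne: "s1 * t2 \<noteq> s2 * t1" "s1 * t3 \<noteq> s3 * t1" "s2 * t3 \<noteq> s3 * t2" and
      zero: "\<And>s t. cubic_form (plane_coeffs A x y z) s t = 0 \<longleftrightarrow>
         s * t1 = s1 * t \<or> s * t2 = s2 * t \<or> s * t3 = s3 * t"
      by (rule cubic_three_zeros) blast
    have nz: "(s1, t1) \<noteq> (0, 0)" "(s2, t2) \<noteq> (0, 0)" "(s3, t3) \<noteq> (0, 0)"
      using ne by auto
    \<comment> \<open>Zeros of either cubic are the common points of the same curve and the same
      plane, so they can be moved from \<open>A\<close> to \<open>A'\<close>.\<close>
    have tr: "\<exists>s' t'. (s', t') \<noteq> (0, 0) \<and> cubic_form (plane_coeffs A' x y z) s' t' = 0 \<and>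
        vec.span {A *v veronese3 s t} = vec.span {A' *v veronese3 s' t'}"
      if st: "(s, t) \<noteq> (0, 0)" "cubic_form (plane_coeffs A x y z) s t = 0" for s t
    proof -
      have "vec.span {A *v veronese3 s t} \<in> cubic_curve A'"
        using st(1) unfolding eq[symmetric] by (auto simp: cubic_curve_def)
      then obtain s' t' where "(s', t') \<noteq> (0, 0)"
        "vec.span {A *v veronese3 s t} = vec.span {A' *v veronese3 s' t'}"
        unfolding cubic_curve_def by blast
      thus ?thesis
        using cubic_curve_point_mem_plane_iff[OF A d st(1)] st(2)
          cubic_curve_point_mem_plane_iff[OF A' d] by metis
    qed
    obtain s1' t1' s2' t2' s3' t3' where
      "(s1', t1') \<noteq> (0, 0)" "cubic_form (plane_coeffs A' x y z) s1' t1' = 0"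
      "vec.span {A *v veronese3 s1 t1} = vec.span {A' *v veronese3 s1' t1'}"
      "(s2', t2') \<noteq> (0, 0)" "cubic_form (plane_coeffs A' x y z) s2' t2' = 0"
      "vec.span {A *v veronese3 s2 t2} = vec.span {A' *v veronese3 s2' t2'}"
      "(s3', t3') \<noteq> (0, 0)" "cubic_form (plane_coeffs A' x y z) s3' t3' = 0"
      "vec.span {A *v veronese3 s3 t3} = vec.span {A' *v veronese3 s3' t3'}"
      using tr[OF nz(1)] tr[OF nz(2)] tr[OF nz(3)] zero by metis
    note P' = this
    \<comment> \<open>The three points in space are distinct, hence so are their parameters with
      respect to \<open>A'\<close>.\<close>
    have "s1' * t2' \<noteq> s2' * t1'" "s1' * t3' \<noteq> s3' * t1'" "s2' * t3' \<noteq> s3' * t2'"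
      using ne P' cubic_curve_point_eq_iff[OF A nz(1) nz(2)]
        cubic_curve_point_eq_iff[OF A nz(1) nz(3)] cubic_curve_point_eq_iff[OF A nz(2) nz(3)]
        cubic_curve_point_eq_iff[OF A' P'(1,4)] cubic_curve_point_eq_iff[OF A' P'(1,7)]
        cubic_curve_point_eq_iff[OF A' P'(4,7)] by metis+
    hence "cubic_disc (plane_coeffs A' x y z) \<noteq> 0"
      using cubic_disc_nonzero_if_three_zeros[OF _ P'(2,5,8)] d
      by (simp add: plane_coeffs_nonzero_iff[OF A'])
    thus False using z' by simp
  qed
qed

subsection \<open>General triples\<close>

text \<open>Expresses general position by polynomials. The dimension condition is encoded in the
  discriminant: dependent points give the coefficient vector 0, whose discriminant is 0. The inverse
  \<open>B\<close> supplies the coordinates in which the minors detect the curve.\<close>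

lemma general_triple_iff:
  fixes A B :: "'a::alg_closed_field^4^4"
  assumes AB: "A ** B = mat 1" "B ** A = mat 1" and nz: "x \<noteq> 0" "y \<noteq> 0" "z \<noteq> 0"
  shows "general_triple (cubic_curve A) (vec.span {x}) (vec.span {y}) (vec.span {z}) \<longleftrightarrow>
    cubic_disc (plane_coeffs A x y z) \<noteq> 0 \<and> (\<exists>G\<in>veronese_quadrics. G (B *v x) \<noteq> 0) \<and>
    (\<exists>G\<in>veronese_quadrics. G (B *v y) \<noteq> 0) \<and> (\<exists>G\<in>veronese_quadrics. G (B *v z) \<noteq> 0)"
proof -
  have A: "invertible A" using AB unfolding invertible_def by blast
  have "invertible B" using AB unfolding invertible_def by blast
  hence mem: "vec.span {u} \<in> cubic_curve A \<longleftrightarrow> (\<forall>G\<in>veronese_quadrics. G (B *v u) = 0)"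
    if "u \<noteq> 0" for u
    using that span_mem_cubic_curve_iff[OF A, of "B *v u"] AB
    by (simp add: matrix_vector_mul_assoc invertible_mult_eq_0_iff)
  have "vec.dim {x, y, z} = 3" if "cubic_disc (plane_coeffs A x y z) \<noteq> 0"
    using that plane_coeffs_nonzero_iff[OF A, of x y z] by (auto simp: cubic_disc_def)
  thus ?thesis
    using nz by (auto simp: general_triple_def plane_through_span_singletons
      dim_Un_span_singletons mem plane_tangent_to_iff[OF A])
qed

section \<open>Polynomial functions on triples and Zariski openness\<close>

lemma poly_function3_uminus:
  assumes "poly_function3 F"
  shows "poly_function3 (\<lambda>x y z. - F x y z)"
  using poly_function3.intros(6)[OF poly_function3.intros(1)[of "-1"] assms] by simp

lemma poly_function3_diff:
  assumes "poly_function3 F" "poly_function3 G"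
  shows "poly_function3 (\<lambda>x y z. F x y z - G x y z)"
  using poly_function3.intros(5)[OF assms(1) poly_function3_uminus[OF assms(2)]] by simp

lemma poly_function3_power:
  assumes "poly_function3 F"
  shows "poly_function3 (\<lambda>x y z. F x y z ^ n)"
  by (induction n) (use assms in \<open>auto intro: poly_function3.intros\<close>)

lemma poly_function3_sum:
  assumes "\<And>i. i \<in> I \<Longrightarrow> poly_function3 (F i)"
  shows "poly_function3 (\<lambda>x y z. \<Sum>i\<in>I. F i x y z)"
  using assms
  by (induction I rule: infinite_finite_induct) (auto intro: poly_function3.intros)

lemma poly_function3_prod:
  assumes "\<And>i. i \<in> I \<Longrightarrow> poly_function3 (F i)"
  shows "poly_function3 (\<lambda>x y z. \<Prod>i\<in>I. F i x y z)"
  using assms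
  by (induction I rule: infinite_finite_induct) (auto intro: poly_function3.intros)

lemmas poly_function3_intros = poly_function3.intros poly_function3_uminus poly_function3_diff
  poly_function3_power poly_function3_sum poly_function3_prod

lemma poly_function3_det:
  fixes M :: "'a::field^4 \<Rightarrow> 'a^4 \<Rightarrow> 'a^4 \<Rightarrow> 'a^'n^'n"
  assumes "\<And>i j. poly_function3 (\<lambda>x y z. M x y z $ i $ j)"
  shows "poly_function3 (\<lambda>x y z. det (M x y z))"
  unfolding det_def by (intro poly_function3_intros assms)

lemma poly_function3_plane_coeffs:
  "poly_function3 (\<lambda>x y z. plane_coeffs A x y z $ i)"
proof -
  have "\<forall>k. poly_function3 (\<lambda>x y z. (vector [column i A, x, y, z] :: 'a^4^4) $ k $ j)" for j
    unfolding forall_4 vector_4 by (intro conjI poly_function3_intros)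
  thus ?thesis unfolding plane_coeffs_def vec_lambda_beta by (intro poly_function3_det) blast
qed

lemma poly_function3_cubic_disc_plane_coeffs:
  "poly_function3 (\<lambda>x y z. cubic_disc (plane_coeffs A x y z))"
  unfolding cubic_disc_def by (intro poly_function3_intros poly_function3_plane_coeffs)

lemma poly_function3_veronese_quadrics:
  assumes "G \<in> veronese_quadrics"
  shows "poly_function3 (\<lambda>x y z. G (B *v x))" "poly_function3 (\<lambda>x y z. G (B *v y))"
    "poly_function3 (\<lambda>x y z. G (B *v z))"
proof -
  have lin: "poly_function3 (\<lambda>x y z. (B *v x) $ i)" "poly_function3 (\<lambda>x y z. (B *v y) $ i)"
    "poly_function3 (\<lambda>x y z. (B *v z) $ i)" for i
    unfolding matrix_vector_mult_def vec_lambda_beta by (intro poly_function3_intros)+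
  show "poly_function3 (\<lambda>x y z. G (B *v x))" "poly_function3 (\<lambda>x y z. G (B *v y))"
    "poly_function3 (\<lambda>x y z. G (B *v z))"
    using assms unfolding veronese_quadrics_def
    by (auto intro!: poly_function3_intros lin)
qed

text \<open>Closed sets test all vectors of a point, including the zero vector; there the defining
  polynomials must vanish as well.\<close>

lemma veronese_quadrics_zero: "G \<in> veronese_quadrics \<Longrightarrow> G 0 = 0"
  by (auto simp: veronese_quadrics_def)

text \<open>A triple fails to be general if the discriminant vanishes or all minors vanish at one of
  the points. Multiplying the discriminant by one independently chosen minor for each point turns
  this disjunction into the vanishing of all products.\<close>

lemma zariski_open3_general_triple:
  fixes A :: "'a::alg_closed_field^4^4"
  assumes "invertible A"
  shows "zariski_open3 {(p, q, r). general_triple (cubic_curve A) p q r}"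
proof -
  let ?P = "proj_space :: ('a^4) set set" and ?C = "cubic_curve A"
  from assms obtain B where AB: "A ** B = mat 1" "B ** A = mat 1"
    unfolding invertible_def by blast
  define S where "S = {\<lambda>x y z. cubic_disc (plane_coeffs A x y z) *
      (G (B *v x) * (G' (B *v y) * G'' (B *v z))) | G G' G''.
      G \<in> veronese_quadrics \<and> G' \<in> veronese_quadrics \<and> G'' \<in> veronese_quadrics}"
  have "\<forall>F\<in>S. poly_function3 F"
    unfolding S_def
    by (auto intro!: poly_function3_intros poly_function3_cubic_disc_plane_coeffs
        poly_function3_veronese_quadrics)
  moreover have "?P \<times> ?P \<times> ?P - {(p, q, r). general_triple ?C p q r} =
      {(p, q, r). p \<in> ?P \<and> q \<in> ?P \<and> r \<in> ?P \<and> (\<forall>F\<in>S. \<forall>x\<in>p. \<forall>y\<in>q. \<forall>z\<in>r. F x y z = 0)}"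
  proof -
    have S0: "(\<forall>F\<in>S. F x y z = 0) \<longleftrightarrow> x = 0 \<or> y = 0 \<or> z = 0 \<or>
        \<not> general_triple ?C (vec.span {x}) (vec.span {y}) (vec.span {z})" for x y z
    proof (cases "x = 0 \<or> y = 0 \<or> z = 0")
      case True
      thus ?thesis unfolding S_def by (auto simp: veronese_quadrics_zero)
    next
      case False
      hence "general_triple ?C (vec.span {x}) (vec.span {y}) (vec.span {z}) \<longleftrightarrow>
          (\<exists>F\<in>S. F x y z \<noteq> 0)"
        unfolding S_def by (subst general_triple_iff[OF AB]) (simp, simp, simp, fastforce)
      thus ?thesis using False by blast
    qed
    have "(\<not> general_triple ?C p q r) \<longleftrightarrow> (\<forall>F\<in>S. \<forall>x\<in>p. \<forall>y\<in>q. \<forall>z\<in>r. F x y z = 0)"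
      if pqr: "p \<in> ?P" "q \<in> ?P" "r \<in> ?P" for p q r
    proof -
      \<comment> \<open>Every nonzero vector of a point spans it, so the condition does not depend
        on representatives.\<close>
      have sp: "vec.span {x} = p" if "p \<in> ?P" "x \<in> p" "x \<noteq> 0" for p and x :: "'a^4"
      proof -
        obtain u where u: "p = vec.span {u}" using \<open>p \<in> ?P\<close> by (auto elim: proj_spaceE)
        then obtain c where "x = c *s u" using \<open>x \<in> p\<close> by (auto simp: vec.span_singleton)
        thus ?thesis using \<open>x \<noteq> 0\<close> u by (subst u, subst span_singleton_eq_iff) auto
      qed
      obtain x y z where g: "x \<noteq> 0" "p = vec.span {x}" "y \<noteq> 0" "q = vec.span {y}"
          "z \<noteq> 0" "r = vec.span {z}"
        using pqr by (metis proj_spaceE)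
      have "x \<in> p" "y \<in> q" "z \<in> r" using g by (simp_all add: vec.span_base)
      have "(\<forall>F\<in>S. F x y z = 0) \<longleftrightarrow> \<not> general_triple ?C p q r"
        using S0[of x y z] g by simp
      moreover have "\<forall>F\<in>S. F x' y' z' = 0"
        if "\<not> general_triple ?C p q r" "x' \<in> p" "y' \<in> q" "z' \<in> r" for x' y' z'
        using S0[of x' y' z'] sp[OF pqr(1) that(2)] sp[OF pqr(2) that(3)] sp[OF pqr(3) that(4)]
          that(1) by fastforce
      ultimately show ?thesis using \<open>x \<in> p\<close> \<open>y \<in> q\<close> \<open>z \<in> r\<close> by blast
    qed
    thus ?thesis by auto
  qed
  moreover have "{(p, q, r). general_triple ?C p q r} \<subseteq> ?P \<times> ?P \<times> ?P"
    by (auto simp: general_triple_def)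
  ultimately show ?thesis
    unfolding zariski_open3_def zariski_closed3_def by blast
qed

text \<open>In the coordinates given by \<open>A\<close>, the plane \<open>w\<^sub>2 = w\<^sub>3\<close> meets the curve at the parameters
  \<open>[1:0]\<close>, \<open>[0:1]\<close> and \<open>[1:1]\<close>.\<close>

lemma general_triple_exists:
  fixes A :: "'a::alg_closed_field^4^4"
  assumes "invertible A"
  shows "\<exists>p q r. general_triple (cubic_curve A) p q r"
proof -
  from assms obtain B where AB: "A ** B = mat 1" "B ** A = mat 1"
    unfolding invertible_def by blast
  \<comment> \<open>Three vectors with equal second and third entries; at each of them some minor
    equals 1, so they are off the curve in every characteristic.\<close>
  define x y z :: "'a^4" where "x = vector [1, 0, 0, 1]" "y = vector [1, 1, 1, 2]"
    "z = vector [2, 1, 1, 2]"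
  note defs = x_y_z_def
  have nz: "x \<noteq> 0" "y \<noteq> 0" "z \<noteq> 0"
    by (auto simp: defs vec_eq_iff forall_4 vector_4)
  define w :: "'a^4" where "w = vector [0, 1, 0, 0]"
  have comb: "A *v (a *s x + b *s y + c *s z) \<in> vec.span {A *v x, A *v y, A *v z}" for a b c
    unfolding matrix_vector_right_distrib vector_scalar_commute
    by (intro vec.span_add vec.span_scale vec.span_base) auto
  have "u \<in> vec.span {A *v w, A *v x, A *v y, A *v z}" for u
  proof -
    obtain c where c: "A *v c = u"
      using AB by (metis matrix_vector_mul_assoc matrix_vector_mul_lid)
    \<comment> \<open>The solution of the linear system has integer coefficients, so the four
      vectors span in every characteristic.\<close>
    have "c = ((c$4 - 2 * c$3) *s x + (c$4 - c$1) *s y + (c$3 - c$4 + c$1) *s z)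
        + (c$2 - c$3) *s w"
      unfolding vec_eq_iff forall_4
      by (simp add: defs w_def vector_4 algebra_simps)
    from arg_cong[OF this, of "(*v) A"]
    have u: "u = A *v ((c$4 - 2 * c$3) *s x + (c$4 - c$1) *s y + (c$3 - c$4 + c$1) *s z)
        + (c$2 - c$3) *s (A *v w)"
      unfolding c matrix_vector_right_distrib[of A _ "_ *s w"] vector_scalar_commute[of A _ w] .
    have "vec.span {A *v x, A *v y, A *v z} \<subseteq> vec.span {A *v w, A *v x, A *v y, A *v z}"
      by (intro vec.span_mono) auto
    thus ?thesis
      by (subst u, intro vec.span_add vec.span_scale subsetD[OF _ comb])
         (auto intro: vec.span_base)
  qed
  hence "det (vector [A *v w, A *v x, A *v y, A *v z]) \<noteq> 0"
    unfolding det_vector_4_nonzero_iff_span by blast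
  hence d: "vec.dim {A *v x, A *v y, A *v z} = 3"
    by (simp add: det_vector_4_nonzero_iff)
  \<comment> \<open>Three points of the curve lie in the plane, which gives the cubic three distinct
    zeros and so a nonzero discriminant.\<close>
  have "veronese3 1 0 = 0 *s x + (- 1) *s y + 1 *s z"
    "veronese3 0 1 = 1 *s x + 1 *s y + (- 1) *s z"
    "veronese3 1 1 = (- 1) *s x + 0 *s y + 1 *s z"
    by (simp_all add: defs veronese3_def vec_eq_iff forall_4 vector_4)
  hence "A *v veronese3 s t \<in> vec.span {A *v x, A *v y, A *v z}"
    if "(s, t) \<in> {(1, 0), (0, 1), (1, 1)}" for s t
    using that by (elim insertE) (simp_all only: prod.inject comb simp_thms empty_iff)
  hence "cubic_form (plane_coeffs A (A *v x) (A *v y) (A *v z)) s t = 0"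
    if "(s, t) \<in> {(1, 0), (0, 1), (1, 1)}" for s t
    using that by (simp only: mem_span_iff_plane_coeffs[OF d] sum_veronese3)
  hence disc: "cubic_disc (plane_coeffs A (A *v x) (A *v y) (A *v z)) \<noteq> 0"
    using d assms
    by (intro cubic_disc_nonzero_if_three_zeros[of _ 1 0 0 1 1 1])
       (simp_all add: plane_coeffs_nonzero_iff)
  have "B *v (A *v u) = u" for u by (simp add: matrix_vector_mul_assoc AB)
  hence "general_triple (cubic_curve A) (vec.span {A *v x}) (vec.span {A *v y})
      (vec.span {A *v z})"
    using disc nz assms
    by (subst general_triple_iff[OF AB])
       (simp_all add: invertible_mult_eq_0_iff veronese_quadrics_def defs vector_4)
  thus ?thesis by blast
qed

subsection \<open>Quadrics and conics\<close>

text \<open>Summing over all ordered pairs, with non-unique coefficients, gives a shape preserved by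
  linear substitution and independent of an order on the indices.\<close>

definition quadratic_form :: "(('a::field)^'n \<Rightarrow> 'a) \<Rightarrow> bool" where
  "quadratic_form F \<longleftrightarrow> (\<exists>e. \<forall>x. F x = (\<Sum>i\<in>UNIV. \<Sum>j\<in>UNIV. e i j * x $ i * x $ j))"

lemma quad_poly_eq_sum:
  fixes x :: "'a::field^'n::{finite,linorder}"
  shows "quad_poly c x = (\<Sum>i\<in>UNIV. \<Sum>j\<in>UNIV. (if i \<le> j then c i j else 0) * x $ i * x $ j)"
proof -
  have "quad_poly c x = (\<Sum>(i,j)\<in>UNIV \<times> UNIV. (if i \<le> j then c i j else 0) * x $ i * x $ j)"
    unfolding quad_poly_def by (intro sum.mono_neutral_cong_left) (auto split: if_splits)
  thus ?thesis by (simp add: sum.cartesian_product)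
qed

text \<open>The terms below the diagonal are reflected and added to those above. Nothing is halved,
  so characteristic 2 is covered.\<close>

lemma quadratic_form_iff_quad_poly:
  fixes F :: "'a::field^'n::{finite,linorder} \<Rightarrow> 'a"
  shows "quadratic_form F \<longleftrightarrow> (\<exists>c. F = quad_poly c)"
proof
  assume "quadratic_form F"
  then obtain e where e: "\<And>x. F x = (\<Sum>i\<in>UNIV. \<Sum>j\<in>UNIV. e i j * x $ i * x $ j)"
    by (auto simp: quadratic_form_def)
  define c where "c i j = (if i = j then e i j else e i j + e j i)" for i j
  have "F x = quad_poly c x" for x
  proof -
    let ?f = "\<lambda>(i, j). e i j * x $ i * x $ j"
    have "F x = sum ?f (UNIV \<times> UNIV)" by (simp add: e sum.cartesian_product)
    also have "UNIV \<times> UNIV = {(i, j). i \<le> j} \<union> {(i, j). j < (i :: 'n)}"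
      by auto
    also have "sum ?f \<dots> = sum ?f {(i, j). i \<le> j} + sum ?f {(i, j). j < i}"
      by (intro sum.union_disjoint) auto
    also have "sum ?f {(i, j). j < i} = (\<Sum>(i, j)\<in>{(i, j). i < j}. ?f (j, i))"
      by (intro sum.reindex_bij_witness[of _ prod.swap prod.swap]) auto
    also have "\<dots> = (\<Sum>(i, j)\<in>{(i, j). i \<le> j}. if i = j then 0 else ?f (j, i))"
      by (intro sum.mono_neutral_cong_left) (auto split: if_splits)
    finally show ?thesis
      unfolding quad_poly_def
      by (simp add: sum.distrib[symmetric] case_prod_unfold c_def algebra_simps if_distrib
          cong: if_cong sum.cong)
         (intro sum.cong, auto simp: algebra_simps)
  qed
  thus "\<exists>c. F = quad_poly c" by blast
next
  assume "\<exists>c. F = quad_poly c"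
  thus "quadratic_form F" by (auto simp: quadratic_form_def quad_poly_eq_sum)
qed

text \<open>Values at unit vectors give the diagonal coefficients and values at sums of two unit
  vectors the mixed ones. So over any field a nonzero quadratic polynomial is the same as one that
  is nonzero somewhere.\<close>

lemma quad_poly_eq_0_iff:
  fixes c :: "'n::{finite,linorder} \<Rightarrow> 'n \<Rightarrow> 'a::field"
  shows "quad_poly c = (\<lambda>x. 0) \<longleftrightarrow> (\<forall>i j. i \<le> j \<longrightarrow> c i j = 0)"
proof
  assume 0: "quad_poly c = (\<lambda>x. 0)"
  let ?e = "\<lambda>i. axis i 1 :: 'a^'n::{finite,linorder}"
  have diag: "c i i = 0" for i
  proof -
    have "quad_poly c (?e i) = (\<Sum>(k, l)\<in>{(i, i)}. c k l)"
      unfolding quad_poly_def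
      by (intro sum.mono_neutral_cong_right) (auto simp: axis_def split: if_splits)
    thus ?thesis by (simp add: 0)
  qed
  have "c i j = 0" if "i < j" for i j
  proof -
    have "quad_poly c (?e i + ?e j) = (\<Sum>(k, l)\<in>{(i, i), (i, j), (j, j)}. c k l)"
      unfolding quad_poly_def using that
      by (intro sum.mono_neutral_cong_right) (auto simp: axis_def split: if_splits)
    thus ?thesis using that by (simp add: 0 diag)
  qed
  thus "\<forall>i j. i \<le> j \<longrightarrow> c i j = 0" using diag by (auto simp: le_less)
qed (auto simp: quad_poly_def fun_eq_iff intro!: sum.neutral)

lemma is_quadric_iff:
  fixes Q :: "('a::field^'n::{finite,linorder}) set set"
  shows "is_quadric Q \<longleftrightarrow> (\<exists>F. quadratic_form F \<and> (\<exists>x. F x \<noteq> 0) \<and>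
     Q = {p \<in> proj_space. \<forall>x\<in>p. F x = 0})"
proof -
  have "(\<exists>i j. i \<le> j \<and> c i j \<noteq> 0) \<longleftrightarrow> (\<exists>x. quad_poly c x \<noteq> 0)" for c :: "'n \<Rightarrow> 'n \<Rightarrow> 'a"
    using quad_poly_eq_0_iff[of c] by (auto simp: fun_eq_iff)
  thus ?thesis unfolding is_quadric_def quadratic_form_iff_quad_poly by auto
qed

lemma quadratic_form_scale:
  assumes "quadratic_form F"
  shows "F (c *s x) = c^2 * F x"
  using assms by (auto simp: quadratic_form_def sum_distrib_left power2_eq_square
    intro!: sum.cong)

lemma quadratic_form_zero_on_span_iff:
  assumes "quadratic_form F"
  shows "(\<forall>x\<in>vec.span {v}. F x = 0) \<longleftrightarrow> F v = 0"
proof -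
  have "vec.span {v} = range (\<lambda>c. c *s v)" by (rule vec.span_singleton)
  moreover have "v \<in> vec.span {v}" by (simp add: vec.span_base)
  ultimately show ?thesis by (auto simp: quadratic_form_scale[OF assms])
qed

lemma quadratic_form_comp:
  fixes M :: "'a::field^'n^'m"
  assumes "quadratic_form F"
  shows "quadratic_form (\<lambda>x. F (M *v x))"
proof -
  obtain e where e: "\<And>x. F x = (\<Sum>i\<in>UNIV. \<Sum>j\<in>UNIV. e i j * x $ i * x $ j)"
    using assms by (auto simp: quadratic_form_def)
  \<comment> \<open>The coefficient matrix of the substituted form, \<open>M\<close> transposed
    times \<open>e\<close> times \<open>M\<close>.\<close>
  define d where "d k l = (\<Sum>i\<in>UNIV. \<Sum>j\<in>UNIV. e i j * M $ i $ k * M $ j $ l)" for k l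
  have "F (M *v x) = (\<Sum>k\<in>UNIV. \<Sum>l\<in>UNIV. d k l * x $ k * x $ l)" for x
  proof -
    have "F (M *v x) = (\<Sum>i\<in>UNIV. \<Sum>j\<in>UNIV. \<Sum>k\<in>UNIV. \<Sum>l\<in>UNIV.
        e i j * M $ i $ k * M $ j $ l * x $ k * x $ l)"
      by (simp add: e matrix_vector_mult_def sum_distrib_left sum_distrib_right mult_ac)
    also have "\<dots> = (\<Sum>i\<in>UNIV. \<Sum>k\<in>UNIV. \<Sum>l\<in>UNIV. \<Sum>j\<in>UNIV.
        e i j * M $ i $ k * M $ j $ l * x $ k * x $ l)"
      by (intro sum.cong refl) (subst sum.swap, intro sum.cong refl sum.swap)
    also have "\<dots> = (\<Sum>k\<in>UNIV. \<Sum>l\<in>UNIV. \<Sum>i\<in>UNIV. \<Sum>j\<in>UNIV.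
        e i j * M $ i $ k * M $ j $ l * x $ k * x $ l)"
      by (subst sum.swap, intro sum.cong refl sum.swap)
    finally show ?thesis by (simp add: d_def sum_distrib_right)
  qed
  thus ?thesis unfolding quadratic_form_def by blast
qed

lemma quadratic_form_add:
  assumes "quadratic_form F" "quadratic_form G"
  shows "quadratic_form (\<lambda>x. F x + G x)"
proof -
  obtain e d where "\<And>x. F x = (\<Sum>i\<in>UNIV. \<Sum>j\<in>UNIV. e i j * x $ i * x $ j)"
    "\<And>x. G x = (\<Sum>i\<in>UNIV. \<Sum>j\<in>UNIV. d i j * x $ i * x $ j)"
    using assms by (auto simp: quadratic_form_def)
  thus ?thesis unfolding quadratic_form_def
    by (intro exI[of _ "\<lambda>i j. e i j + d i j"]) (simp add: sum.distrib algebra_simps)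
qed

lemma quadratic_form_cmult:
  assumes "quadratic_form F"
  shows "quadratic_form (\<lambda>x. c * F x)"
proof -
  obtain e where "\<And>x. F x = (\<Sum>i\<in>UNIV. \<Sum>j\<in>UNIV. e i j * x $ i * x $ j)"
    using assms by (auto simp: quadratic_form_def)
  thus ?thesis unfolding quadratic_form_def
    by (intro exI[of _ "\<lambda>i j. c * e i j"]) (simp add: sum_distrib_left mult_ac)
qed

section \<open>The net of quadrics through the curve and its restriction to a secant plane\<close>

lemma quadratic_form_veronese_quadrics:
  assumes "G \<in> veronese_quadrics"
  shows "quadratic_form G"
proof -
  have mon: "quadratic_form (\<lambda>w::'a^4. w $ k * w $ l)" for k l
    unfolding quadratic_form_def
    by (intro exI[of _ "\<lambda>i j. if i = k \<and> j = l then 1 else 0"])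
       (use exhaust_4[of k] exhaust_4[of l] in \<open>auto simp: sum_4\<close>)
  have "quadratic_form (\<lambda>w::'a^4. w $ k * w $ l + (- 1) * (w $ m * w $ n))" for k l m n
    by (intro quadratic_form_add quadratic_form_cmult mon)
  thus ?thesis using assms by (auto simp: veronese_quadrics_def power2_eq_square)
qed

text \<open>On the chart \<open>s = 1\<close> the form becomes a polynomial of degree at most 6 in
  \<open>t\<close> with infinitely many zeros. Its seven coefficients therefore vanish, and these
  relations leave only combinations of the three minors.\<close>

lemma quadratic_form_vanishing_on_veronese3:
  fixes F :: "'a::alg_closed_field^4 \<Rightarrow> 'a"
  assumes F: "quadratic_form F" and 0: "\<And>s t. F (veronese3 s t) = 0"
  obtains a b c where "\<And>w. F w = a * (w$1 * w$3 - (w$2)^2) + b * (w$2 * w$4 - (w$3)^2)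
    + c * (w$1 * w$4 - w$2 * w$3)"
proof -
  obtain e where e: "\<And>x. F x = (\<Sum>i\<in>UNIV. \<Sum>j\<in>UNIV. e i j * x $ i * x $ j)"
    using F by (auto simp: quadratic_form_def)
  \<comment> \<open>The term \<open>e i j\<close> contributes to the power
    \<open>t^(i + j - 2)\<close>.\<close>
  define P where "P = [:e 1 1, e 1 2 + e 2 1, e 1 3 + e 3 1 + e 2 2,
    e 1 4 + e 4 1 + e 2 3 + e 3 2, e 2 4 + e 4 2 + e 3 3, e 3 4 + e 4 3, e 4 4:]"
  have "poly P t = F (veronese3 1 t)" for t
    by (simp add: e sum_4 veronese3_def vector_4 P_def algebra_simps power2_eq_square
        power3_eq_cube)
  hence "P = 0" using 0 by (intro poly_zero_on_UNIV_imp_zero) simp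
  hence c: "e 1 1 = 0" "e 1 2 + e 2 1 = 0" "e 1 3 + e 3 1 + e 2 2 = 0"
    "e 1 4 + e 4 1 + e 2 3 + e 3 2 = 0" "e 2 4 + e 4 2 + e 3 3 = 0" "e 3 4 + e 4 3 = 0"
    "e 4 4 = 0"
    by (auto simp: P_def)
  have "F w = (e 1 3 + e 3 1) * (w$1 * w$3 - (w$2)^2) + (e 2 4 + e 4 2) * (w$2 * w$4 - (w$3)^2)
    + (e 1 4 + e 4 1) * (w$1 * w$4 - w$2 * w$3)" for w
    unfolding e sum_4 using c by algebra
  thus ?thesis by (rule that)
qed

text \<open>Parametrizes a secant plane so that the coordinate points go to the three points of the
  curve. The transpose is taken because \<open>vector\<close> lists rows and these points are the
  columns.\<close>

definition veronese_comb :: "'a::field \<Rightarrow> 'a \<Rightarrow> 'a \<Rightarrow> 'a \<Rightarrow> 'a \<Rightarrow> 'a \<Rightarrow> 'a^3^4" where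
  "veronese_comb s1 t1 s2 t2 s3 t3 =
     transpose (vector [veronese3 s1 t1, veronese3 s2 t2, veronese3 s3 t3])"

lemma veronese_comb_mult:
  "veronese_comb s1 t1 s2 t2 s3 t3 *v x =
     x$1 *s veronese3 s1 t1 + x$2 *s veronese3 s2 t2 + x$3 *s veronese3 s3 t3"
  by (simp add: veronese_comb_def matrix_vector_mult_def transpose_def sum_3 vec_eq_iff
      mult.commute)

text \<open>The columns lie on the curve, so no squares occur. A mixed coefficient is the polarized
  quadric at two points of the curve, and it factors into the squared bracket of the parameters and
  a symmetric bilinear form with matrix entries \<open>a\<close>, \<open>c\<close>,
  \<open>c\<close>, \<open>b\<close>.\<close>

lemma minors_veronese_comb:
  fixes a b c :: "'a::field"
  defines "\<phi> \<equiv> (\<lambda>s t s' t'. (s * t' - s' * t)^2 *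
    (a * (s * s') + b * (t * t') + c * (s * t' + s' * t)))"
  assumes "w = veronese_comb s1 t1 s2 t2 s3 t3 *v x"
  shows "a * (w$1 * w$3 - (w$2)^2) + b * (w$2 * w$4 - (w$3)^2) + c * (w$1 * w$4 - w$2 * w$3) =
    x$1 * x$2 * \<phi> s1 t1 s2 t2 + x$1 * x$3 * \<phi> s1 t1 s3 t3 + x$2 * x$3 * \<phi> s2 t2 s3 t3"
  unfolding assms veronese_comb_mult veronese3_def vector_add_component
    vector_smult_component vector_4 by algebra

text \<open>With the first parameter fixed, the form is linear in the other argument and vanishes at
  two distinct parameters, so it is zero; likewise for the second parameter. These two parameters
  are independent, so the whole bilinear form vanishes.\<close>

lemma binary_symmetric_form_zero:
  fixes a b c :: "'a::field"
  defines "\<beta> \<equiv> (\<lambda>s t s' t'. a * (s * s') + b * (t * t') + c * (s * t' + s' * t))"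
  assumes z: "\<beta> s1 t1 s2 t2 = 0" "\<beta> s1 t1 s3 t3 = 0" "\<beta> s2 t2 s3 t3 = 0"
    and d: "s1 * t2 \<noteq> s2 * t1" "s1 * t3 \<noteq> s3 * t1" "s2 * t3 \<noteq> s3 * t2"
  shows "a = 0 \<and> b = 0 \<and> c = 0"
proof -
  have "(a * s1 + c * t1) * (s2 * t3 - s3 * t2) = 0" "(c * s1 + b * t1) * (s2 * t3 - s3 * t2) = 0"
    using z(1,2) unfolding \<beta>_def by algebra+
  hence 1: "a * s1 + c * t1 = 0" "c * s1 + b * t1 = 0" using d by auto
  have "(a * s2 + c * t2) * (s1 * t3 - s3 * t1) = 0" "(c * s2 + b * t2) * (s1 * t3 - s3 * t1) = 0"
    using z(1,3) unfolding \<beta>_def by algebra+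
  hence 2: "a * s2 + c * t2 = 0" "c * s2 + b * t2 = 0" using d by auto
  have "a * (s1 * t2 - s2 * t1) = 0" "b * (s1 * t2 - s2 * t1) = 0" "c * (s1 * t2 - s2 * t1) = 0"
    using 1 2 by algebra+
  thus ?thesis using d by auto
qed

text \<open>Injectivity of the restriction from the net to the secant plane.\<close>

lemma quadratic_form_eq_0_if_zero_on_secant_plane:
  fixes F :: "'a::alg_closed_field^4 \<Rightarrow> 'a"
  assumes F: "quadratic_form F" and F0: "\<And>s t. F (veronese3 s t) = 0"
    and d: "s1 * t2 \<noteq> s2 * t1" "s1 * t3 \<noteq> s3 * t1" "s2 * t3 \<noteq> s3 * t2"
    and U0: "\<And>x. F (veronese_comb s1 t1 s2 t2 s3 t3 *v x) = 0"
  shows "F w = 0"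
proof -
  obtain a b c where abc: "\<And>w. F w = a * (w$1 * w$3 - (w$2)^2) + b * (w$2 * w$4 - (w$3)^2)
    + c * (w$1 * w$4 - w$2 * w$3)"
    using quadratic_form_vanishing_on_veronese3[OF F F0] by blast
  note * = U0[unfolded abc minors_veronese_comb[OF refl]]
  \<comment> \<open>A vector with exactly two entries 1 singles out one mixed coefficient, whose
    squared bracket is nonzero and cancels.\<close>
  have "a = 0 \<and> b = 0 \<and> c = 0"
    using *[of "vector [1, 1, 0]"] *[of "vector [1, 0, 1]"] *[of "vector [0, 1, 1]"] d
    by (intro binary_symmetric_form_zero[of a s1 s2 b t1 t2 c s3 t3]) simp_all
  thus ?thesis by (simp add: abc)
qed

text \<open>Symmetric bilinear forms \<open>\<beta>\<close> take arbitrary values at the three pairs of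
  parameters: \<open>\<beta>(P, P') = [P, P\<^sub>3] [P', P\<^sub>3]\<close> vanishes at all pairs except \<open>P\<^sub>1, P\<^sub>2\<close>.\<close>

lemma quadratic_form_extends_from_secant_plane:
  fixes s1 :: "'a::field"
  assumes d: "s1 * t2 \<noteq> s2 * t1" "s1 * t3 \<noteq> s3 * t1" "s2 * t3 \<noteq> s3 * t2"
  obtains F where "quadratic_form F" "\<And>s t. F (veronese3 s t) = 0"
    "\<And>x. F (veronese_comb s1 t1 s2 t2 s3 t3 *v x) =
       k1 * (x$2 * x$3) + k2 * (x$1 * x$3) + k3 * (x$1 * x$2)"
proof -
  define d12 d13 d23 where "d12 = s1 * t2 - s2 * t1" "d13 = s1 * t3 - s3 * t1"
    "d23 = s2 * t3 - s3 * t2"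
  note dd = d12_d13_d23_def
  have nz: "d12 \<noteq> 0" "d13 \<noteq> 0" "d23 \<noteq> 0" using d by (auto simp: dd)
  \<comment> \<open>The weights of the three special forms: each target coefficient is divided by
    the value of its form times the squared bracket. The sign in \<open>m2\<close> comes from
    \<open>[P1,P2] [P3,P2] = - d12 * d23\<close>.\<close>
  define m1 m2 m3 where "m1 = k1 / (d12 * d13 * d23^2)" "m2 = - k2 / (d12 * d13^2 * d23)"
    "m3 = k3 / (d12^2 * d13 * d23)"
  note mm = m1_m2_m3_def
  \<comment> \<open>Expanding \<open>[P,Pi] [P',Pi]\<close> gives the entries \<open>ti^2\<close>,
    \<open>si^2\<close> and \<open>- si * ti\<close>.\<close>
  define a b c where "a = m1 * t1^2 + m2 * t2^2 + m3 * t3^2"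
    "b = m1 * s1^2 + m2 * s2^2 + m3 * s3^2" "c = - (m1 * s1 * t1 + m2 * s2 * t2 + m3 * s3 * t3)"
  note abc = a_b_c_def
  define F where "F = (\<lambda>w::'a^4. a * (w$1 * w$3 - (w$2)^2) + b * (w$2 * w$4 - (w$3)^2)
    + c * (w$1 * w$4 - w$2 * w$3))"
  have "quadratic_form F" unfolding F_def
    by (intro quadratic_form_add quadratic_form_cmult quadratic_form_veronese_quadrics)
       (auto simp: veronese_quadrics_def)
  moreover have "F (veronese3 s t) = 0" for s t
    unfolding F_def veronese3_def vector_4 by algebra
  moreover have "F (veronese_comb s1 t1 s2 t2 s3 t3 *v x) =
      k1 * (x$2 * x$3) + k2 * (x$1 * x$3) + k3 * (x$1 * x$2)" for x
  proof -
    have "k1 = m1 * (d12 * d13 * d23^2)" "k2 = - m2 * (d12 * d13^2 * d23)"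
      "k3 = m3 * (d12^2 * d13 * d23)"
      using nz by (simp_all add: mm)
    thus ?thesis
      unfolding F_def minors_veronese_comb[OF refl] abc dd by algebra
  qed
  ultimately show ?thesis by (rule that)
qed

text \<open>At a kernel vector every extended form takes its value at 0, which is 0. Hence all
  products of two coordinates vanish and at most one coordinate is nonzero; but the columns are
  nonzero.\<close>

lemma inj_veronese_comb:
  fixes s1 :: "'a::field"
  assumes d: "s1 * t2 \<noteq> s2 * t1" "s1 * t3 \<noteq> s3 * t1" "s2 * t3 \<noteq> s3 * t2"
  shows "inj ((*v) (veronese_comb s1 t1 s2 t2 s3 t3))"
proof -
  let ?U = "veronese_comb s1 t1 s2 t2 s3 t3"
  have "x = 0" if U: "?U *v x = 0" for x
  proof -
    have k: "k1 * (x$2 * x$3) + k2 * (x$1 * x$3) + k3 * (x$1 * x$2) = 0" for k1 k2 k3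
    proof -
      obtain F where "quadratic_form F"
        "F (?U *v x) = k1 * (x$2 * x$3) + k2 * (x$1 * x$3) + k3 * (x$1 * x$2)"
        using quadratic_form_extends_from_secant_plane[OF d] by metis
      moreover have "F (0 *s 0) = 0"
        by (subst quadratic_form_scale[OF \<open>quadratic_form F\<close>]) simp
      ultimately show ?thesis by (simp add: U)
    qed
    have "x$2 * x$3 = 0" "x$1 * x$3 = 0" "x$1 * x$2 = 0"
      using k[of 1 0 0] k[of 0 1 0] k[of 0 0 1] by simp_all
    moreover have "veronese3 s1 t1 \<noteq> 0" "veronese3 s2 t2 \<noteq> 0" "veronese3 s3 t3 \<noteq> 0"
      using d by auto
    ultimately show "x = 0"
      using U by (auto simp: veronese_comb_mult vec_eq_iff[of x] forall_3)
  qed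
  thus ?thesis
    by (intro injI) (metis eq_iff_diff_eq_0 matrix_vector_mult_diff_distrib)
qed

lemma quadratic_form_3_zero_at_axes:
  fixes F :: "'a::field^3 \<Rightarrow> 'a"
  assumes F: "quadratic_form F" and 0: "\<And>i. F (axis i 1) = 0"
  obtains k1 k2 k3 where "\<And>x. F x = k1 * (x$2 * x$3) + k2 * (x$1 * x$3) + k3 * (x$1 * x$2)"
proof -
  obtain e where e: "\<And>x. F x = (\<Sum>i\<in>UNIV. \<Sum>j\<in>UNIV. e i j * x $ i * x $ j)"
    using F by (auto simp: quadratic_form_def)
  have "e 1 1 = 0" "e 2 2 = 0" "e 3 3 = 0"
    using 0[of 1] 0[of 2] 0[of 3] by (simp_all add: e sum_3 axis_def)
  hence "F x = (e 2 3 + e 3 2) * (x$2 * x$3) + (e 1 3 + e 3 1) * (x$1 * x$3)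
      + (e 1 2 + e 2 1) * (x$1 * x$2)" for x
    by (simp add: e sum_3 algebra_simps)
  thus ?thesis by (rule that)
qed

section \<open>Conics in a plane of projective space\<close>

lemma image_span_singleton:
  fixes M :: "'a::field^'n^'m"
  shows "(*v) M ` vec.span {v} = vec.span {M *v v}"
  by (auto simp: vec.span_singleton vector_scalar_commute image_iff)

lemma subspace_range_matrix_vector_mult:
  fixes L :: "'a::field^'m^'n"
  shows "vec.subspace (range ((*v) L))"
  unfolding vec.subspace_def
  by (auto simp flip: matrix_vector_right_distrib vector_scalar_commute)
     (metis matrix_vector_mult_0_right rangeI)

lemma conic_in_plane_iff_quadratic_form:
  "conic_in_plane H K \<longleftrightarrow> (\<exists>(M :: 'a::field^3^4) F. inj ((*v) M) \<and> H = proj (range ((*v) M)) \<and>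
     quadratic_form F \<and> (\<exists>x. F x \<noteq> 0) \<and> K = {vec.span {M *v x} | x. x \<noteq> 0 \<and> F x = 0})"
proof -
  have img: "(\<lambda>p. (*v) M ` p) ` {p \<in> proj_space. \<forall>x\<in>p. F x = 0} =
      {vec.span {M *v x} | x. x \<noteq> 0 \<and> F x = 0}"
    if F: "quadratic_form F" for F :: "'a^3 \<Rightarrow> 'a" and M :: "'a^3^4"
  proof -
    have "{p \<in> proj_space. \<forall>x\<in>p. F x = 0} = (\<lambda>x. vec.span {x}) ` {x. x \<noteq> 0 \<and> F x = 0}"
      using quadratic_form_zero_on_span_iff[OF F] by (auto simp: proj_def)
    thus ?thesis by (auto simp: image_image image_span_singleton)
  qed
  show ?thesis
  proof
    assume "conic_in_plane H K"
    then obtain M :: "'a^3^4" and D where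
      M: "inj ((*v) M)" "H = proj (range ((*v) M))" "is_quadric D" "K = (\<lambda>p. (*v) M ` p) ` D"
      unfolding conic_in_plane_def by blast
    from M(3) obtain F where F: "quadratic_form F" "\<exists>x. F x \<noteq> 0"
      "D = {p \<in> proj_space. \<forall>x\<in>p. F x = 0}"
      unfolding is_quadric_iff by blast
    have "K = {vec.span {M *v x} | x. x \<noteq> 0 \<and> F x = 0}"
      unfolding M(4) F(3) by (rule img[OF F(1)])
    thus "\<exists>(M :: 'a^3^4) F. inj ((*v) M) \<and> H = proj (range ((*v) M)) \<and> quadratic_form F \<and>
        (\<exists>x. F x \<noteq> 0) \<and> K = {vec.span {M *v x} | x. x \<noteq> 0 \<and> F x = 0}"
      by (intro exI[of _ M] exI[of _ F] conjI M F)
  next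
    assume "\<exists>(M :: 'a^3^4) F. inj ((*v) M) \<and> H = proj (range ((*v) M)) \<and> quadratic_form F \<and>
        (\<exists>x. F x \<noteq> 0) \<and> K = {vec.span {M *v x} | x. x \<noteq> 0 \<and> F x = 0}"
    then obtain M :: "'a^3^4" and F where M: "inj ((*v) M)" "H = proj (range ((*v) M))"
      and F: "quadratic_form F" "\<exists>x. F x \<noteq> 0"
      and K: "K = {vec.span {M *v x} | x. x \<noteq> 0 \<and> F x = 0}"
      by blast
    have "is_quadric {p \<in> proj_space. \<forall>x\<in>p. F x = 0}"
      unfolding is_quadric_iff using F by blast
    thus "conic_in_plane H K"
      unfolding conic_in_plane_def using M img[OF F(1), of M, folded K] by blast
  qed
qed

text \<open>Allows a parametrization of the plane to be fixed in advance: two injective ones with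
  the same range differ by a bijective linear \<open>N\<close>, and the form \<open>F\<close> is
  replaced by its composition with \<open>N\<close>.\<close>

lemma conic_in_plane_iff:
  fixes U :: "'a::field^3^4"
  assumes U: "inj ((*v) U)"
  shows "conic_in_plane (proj (range ((*v) U))) K \<longleftrightarrow>
    (\<exists>F. quadratic_form F \<and> (\<exists>x. F x \<noteq> 0) \<and> K = {vec.span {U *v x} | x. x \<noteq> 0 \<and> F x = 0})"
proof
  show "conic_in_plane (proj (range ((*v) U))) K"
    if "\<exists>F. quadratic_form F \<and> (\<exists>x. F x \<noteq> 0) \<and> K = {vec.span {U *v x} | x. x \<noteq> 0 \<and> F x = 0}"
    using that U unfolding conic_in_plane_iff_quadratic_form by blast
  assume "conic_in_plane (proj (range ((*v) U))) K"
  then obtain M :: "'a^3^4" and F :: "'a^3 \<Rightarrow> 'a" where M: "inj ((*v) M)"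
    and r: "proj (range ((*v) U)) = proj (range ((*v) M))"
    and F: "quadratic_form F" "\<exists>x. F x \<noteq> 0"
    and K: "K = {vec.span {M *v x} | x. x \<noteq> 0 \<and> F x = 0}"
    unfolding conic_in_plane_iff_quadratic_form by blast
  have r: "range ((*v) U) = range ((*v) M)" 
    using proj_inject[OF subspace_range_matrix_vector_mult subspace_range_matrix_vector_mult r] .
  have "\<exists>n. M *v n = column i U" for i
  proof -
    have "U *v axis i 1 = column i U"
      by (simp add: vec_eq_iff matrix_vector_mult_def column_def axis_def if_distrib cong: if_cong)
    hence "column i U \<in> range ((*v) U)" by (metis rangeI)
    thus ?thesis unfolding r by (metis imageE)
  qed
  then obtain n where n: "\<And>i. M *v n i = column i U" by metis
  \<comment> \<open>The columns of \<open>N\<close> are the preimages under \<open>M\<close> of the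
    columns of \<open>U\<close>, so that \<open>M ** N\<close> acts as \<open>U\<close>.\<close>
  define N :: "'a^3^3" where "N = transpose (\<chi> i. n i)"
  have "column i N = n i" for i by (simp add: N_def column_def transpose_def vec_eq_iff)
  hence N: "M *v (N *v x) = U *v x" for x
    using n by (simp add: matrix_mult_sum[of N] matrix_mult_sum[of U] vec.linear_sum
      matrix_vector_mul_linear_gen vec.linear_scale)
  have surj: "\<exists>x. N *v x = y" for y
  proof -
    have "M *v y \<in> range ((*v) U)" unfolding r by blast
    thus ?thesis using N M by (metis imageE injD)
  qed
  have N0: "N *v x = 0 \<longleftrightarrow> x = 0" for x
    using N[of x] U by (metis injD matrix_vector_mult_0_right)
  have "\<exists>x. F (N *v x) \<noteq> 0" using F(2) surj by metis
  moreover have "K = {vec.span {U *v x} | x. x \<noteq> 0 \<and> F (N *v x) = 0}"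
  proof -
    have 1: "{x. x \<noteq> 0 \<and> F x = 0} = (*v) N ` {x. x \<noteq> 0 \<and> F (N *v x) = 0}"
      using surj N0 by (auto simp: image_iff) metis
    have "K = (\<lambda>x. vec.span {M *v x}) ` {x. x \<noteq> 0 \<and> F x = 0}"
      unfolding K by auto
    thus ?thesis unfolding 1 by (auto simp: image_image N)
  qed
  ultimately show "\<exists>F. quadratic_form F \<and> (\<exists>x. F x \<noteq> 0) \<and>
      K = {vec.span {U *v x} | x. x \<noteq> 0 \<and> F x = 0}"
    using quadratic_form_comp[OF F(1), of N] by (intro exI[of _ "\<lambda>x. F (N *v x)"] conjI)
qed


section \<open>The plane of a general triple; quadrics versus conics\<close>

lemma range_eq_span_if_three_columns:
  fixes L :: "'a::field^3^'n"
  assumes inj: "inj ((*v) L)" and sub: "range ((*v) L) \<subseteq> vec.span S" and d: "vec.dim S = 3"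
  shows "range ((*v) L) = vec.span S"
proof -
  have "vec.dim (range ((*v) L)) = vec.dim (UNIV :: ('a^3) set)"
    by (intro vec.dim_image_eq matrix_vector_mul_linear_gen) (use inj in simp)
  hence "vec.dim (range ((*v) L)) = 3" by (simp add: vec.dimension_def card_cart_basis)
  thus ?thesis
    using sub d by (intro vec.subspace_dim_equal subspace_range_matrix_vector_mult) auto
qed

text \<open>The three distinct zeros of the cubic are the parameters of the intersection points.
  These span a three-dimensional subspace inside that of the plane, hence all of it. The given
  points are off the curve and so differ from them.\<close>

lemma general_triple_secant_plane:
  fixes A :: "'a::alg_closed_field^4^4"
  assumes A: "invertible A" and gen: "general_triple (cubic_curve A) p q r"
  obtains s1 t1 s2 t2 s3 t3 where
    "s1 * t2 \<noteq> s2 * t1" "s1 * t3 \<noteq> s3 * t1" "s2 * t3 \<noteq> s3 * t2"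
    "plane_through p q r = proj (range ((*v) (A ** veronese_comb s1 t1 s2 t2 s3 t3)))"
    "cubic_curve A \<inter> plane_through p q r = {vec.span {A *v veronese3 s1 t1},
       vec.span {A *v veronese3 s2 t2}, vec.span {A *v veronese3 s3 t3}}"
    "distinct [p, q, r, vec.span {A *v veronese3 s1 t1},
       vec.span {A *v veronese3 s2 t2}, vec.span {A *v veronese3 s3 t3}]"
proof -
  have P: "p \<in> proj_space" "q \<in> proj_space" "r \<in> proj_space"
    "p \<notin> cubic_curve A" "q \<notin> cubic_curve A" "r \<notin> cubic_curve A"
    using gen by (auto simp: general_triple_def)
  obtain x y z where g: "x \<noteq> 0" "p = vec.span {x}" "y \<noteq> 0" "q = vec.span {y}"
    "z \<noteq> 0" "r = vec.span {z}"
    using P(1-3) by (metis proj_spaceE)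
  have d: "vec.dim {x, y, z} = 3"
    using gen unfolding general_triple_def g dim_Un_span_singletons by blast
  have H: "plane_through p q r = proj (vec.span {x, y, z})"
    unfolding g by (rule plane_through_span_singletons)
  let ?h = "plane_coeffs A x y z"
  have "cubic_disc ?h \<noteq> 0"
    using gen plane_tangent_to_iff[OF A d] unfolding general_triple_def H by blast
  then obtain s1 t1 s2 t2 s3 t3 where
    ne: "s1 * t2 \<noteq> s2 * t1" "s1 * t3 \<noteq> s3 * t1" "s2 * t3 \<noteq> s3 * t2" and
    zero: "\<And>s t. cubic_form ?h s t = 0 \<longleftrightarrow> s * t1 = s1 * t \<or> s * t2 = s2 * t \<or> s * t3 = s3 * t"
    by (rule cubic_three_zeros) blast
  have nz: "(s1, t1) \<noteq> (0, 0)" "(s2, t2) \<noteq> (0, 0)" "(s3, t3) \<noteq> (0, 0)"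
    using ne by auto
  let ?X1 = "vec.span {A *v veronese3 s1 t1}" and ?X2 = "vec.span {A *v veronese3 s2 t2}"
    and ?X3 = "vec.span {A *v veronese3 s3 t3}"
  let ?U = "veronese_comb s1 t1 s2 t2 s3 t3"
  have inter: "cubic_curve A \<inter> plane_through p q r = {?X1, ?X2, ?X3}"
  proof -
    have "vec.span {A *v veronese3 s t} \<in> plane_through p q r \<longleftrightarrow>
        vec.span {A *v veronese3 s t} \<in> {?X1, ?X2, ?X3}" if "(s, t) \<noteq> (0, 0)" for s t
      unfolding H cubic_curve_point_mem_plane_iff[OF A d that] zero insert_iff empty_iff
        cubic_curve_point_eq_iff[OF A that nz(1)] cubic_curve_point_eq_iff[OF A that nz(2)]
        cubic_curve_point_eq_iff[OF A that nz(3)] by simp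
    moreover have "{?X1, ?X2, ?X3} \<subseteq> cubic_curve A"
      using nz unfolding cubic_curve_def by blast
    ultimately show ?thesis by (auto simp: cubic_curve_def)
  qed
  have dX: "?X1 \<noteq> ?X2" "?X1 \<noteq> ?X3" "?X2 \<noteq> ?X3"
    using ne by (simp_all only: cubic_curve_point_eq_iff[OF A] nz not_False_eq_True simp_thms)
  have "{?X1, ?X2, ?X3} \<subseteq> cubic_curve A" using inter by blast
  moreover have "p \<noteq> q \<and> p \<noteq> r \<and> q \<noteq> r"
  proof -
    \<comment> \<open>If two of the given points coincided, two vectors would span the
      plane.\<close>
    have "vec.dim (vec.span {u} \<union> vec.span {v}) \<le> 2" for u v :: "'a^4"
    proof -
      have "vec.dim (vec.span {u} \<union> vec.span {v}) \<le> card {u, v}"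
        by (intro vec.dim_le_card) (auto intro: subsetD[OF vec.span_mono])
      also have "\<dots> \<le> 2" by (simp add: card_insert_if)
      finally show ?thesis .
    qed
    hence "vec.dim (p \<union> q) \<le> 2" "vec.dim (p \<union> r) \<le> 2" using g by auto
    moreover have "vec.dim (p \<union> q \<union> r) = 3" using gen by (simp add: general_triple_def)
    ultimately show ?thesis by (auto simp: Un_ac)
  qed
  ultimately have "distinct [p, q, r, ?X1, ?X2, ?X3]" using P dX by auto
  moreover have "plane_through p q r = proj (range ((*v) (A ** ?U)))"
  proof -
    have "inj ((*v) (A ** ?U))"
      using inj_veronese_comb[OF ne] inj_matrix_vector_mult[OF A]
      by (simp add: inj_def flip: matrix_vector_mul_assoc)
    moreover have "range ((*v) (A ** ?U)) \<subseteq> vec.span {x, y, z}"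
    proof -
      have X: "A *v veronese3 s1 t1 \<in> vec.span {x, y, z}"
        "A *v veronese3 s2 t2 \<in> vec.span {x, y, z}"
        "A *v veronese3 s3 t3 \<in> vec.span {x, y, z}"
        using zero by (simp_all add: mem_span_iff_plane_coeffs[OF d] sum_veronese3)
      have "A *v (?U *v a) \<in> vec.span {x, y, z}" for a
        unfolding veronese_comb_mult matrix_vector_right_distrib vector_scalar_commute
        by (intro vec.span_add vec.span_scale X)
      thus ?thesis by (auto simp flip: matrix_vector_mul_assoc)
    qed
    ultimately show ?thesis
      unfolding H by (subst range_eq_span_if_three_columns[OF _ _ d]) simp_all
  qed
  ultimately show ?thesis using that ne inter by blast
qed

text \<open>A quadric is sent to its section by the plane, which is a genuine conic because
  restriction is injective on the net. Conversely, a conic through the three points of the curve has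
  only mixed terms in the secant coordinates and extends to a quadric of the net.\<close>

lemma quadric_iff_conic:
  fixes A :: "'a::alg_closed_field^4^4"
  assumes A: "invertible A" and gen: "general_triple (cubic_curve A) p q r"
  shows "(\<exists>Q. quadric_surface Q \<and> cubic_curve A \<union> {p, q, r} \<subseteq> Q) \<longleftrightarrow>
    (\<exists>K. conic_in_plane (plane_through p q r) K \<and>
       {p, q, r} \<union> (cubic_curve A \<inter> plane_through p q r) \<subseteq> K)"
proof
  obtain s1 t1 s2 t2 s3 t3 where
    ne: "s1 * t2 \<noteq> s2 * t1" "s1 * t3 \<noteq> s3 * t1" "s2 * t3 \<noteq> s3 * t2" and
    H: "plane_through p q r = proj (range ((*v) (A ** veronese_comb s1 t1 s2 t2 s3 t3)))" and
    inter: "cubic_curve A \<inter> plane_through p q r = {vec.span {A *v veronese3 s1 t1},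
       vec.span {A *v veronese3 s2 t2}, vec.span {A *v veronese3 s3 t3}}"
    by (rule general_triple_secant_plane[OF A gen])
  define U where "U = veronese_comb s1 t1 s2 t2 s3 t3"
  define L where "L = A ** U"
  have H: "plane_through p q r = proj (range ((*v) L))" unfolding H L_def U_def ..
  have L: "L *v a = A *v (U *v a)" for a by (simp add: L_def matrix_vector_mul_assoc)
  have injL: "inj ((*v) L)"
    using inj_veronese_comb[OF ne] inj_matrix_vector_mult[OF A]
    by (auto simp: inj_def L U_def)
  hence L0: "L *v a = 0 \<longleftrightarrow> a = 0" for a by (metis injD matrix_vector_mult_0_right)
  obtain B where AB: "A ** B = mat 1" "B ** A = mat 1" using A unfolding invertible_def by blast
  have BA: "B *v (A *v u) = u" "A *v (B *v u) = u" for u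
    using AB by (simp_all add: matrix_vector_mul_assoc)
  have pts: "\<exists>a. a \<noteq> 0 \<and> P = vec.span {L *v a}" if "P \<in> plane_through p q r" for P
    using that unfolding H by (auto simp: proj_def L0)
  have "p \<in> plane_through p q r" "q \<in> plane_through p q r" "r \<in> plane_through p q r"
  proof -
    have "p \<in> proj_space" "q \<in> proj_space" "r \<in> proj_space"
      using gen by (auto simp: general_triple_def)
    then obtain x y z where g: "x \<noteq> 0" "p = vec.span {x}" "y \<noteq> 0" "q = vec.span {y}"
      "z \<noteq> 0" "r = vec.span {z}" by (metis proj_spaceE)
    show "p \<in> plane_through p q r" "q \<in> plane_through p q r" "r \<in> plane_through p q r"
      unfolding g plane_through_span_singletons using g
      by (simp_all add: span_singleton_mem_proj_iff vec.span_base)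
  qed
  hence six: "{p, q, r} \<union> (cubic_curve A \<inter> plane_through p q r) \<subseteq> plane_through p q r" by blast
  {
    assume "\<exists>Q. quadric_surface Q \<and> cubic_curve A \<union> {p, q, r} \<subseteq> Q"
    then obtain F where F: "quadratic_form F" "\<exists>x. F x \<noteq> 0" and
      sub: "cubic_curve A \<union> {p, q, r} \<subseteq> {p \<in> proj_space. \<forall>x\<in>p. F x = 0}"
      unfolding is_quadric_iff by blast
    define K where "K = {vec.span {L *v a} | a. a \<noteq> 0 \<and> F (L *v a) = 0}"
    have "F (A *v veronese3 s t) = 0" for s t
    proof (cases "(s, t) = (0, 0)")
      case True
      hence "A *v veronese3 s t = 0" by (simp add: invertible_mult_eq_0_iff[OF A])
      moreover have "F 0 = 0" using quadratic_form_scale[OF F(1), of 0 0] by simp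
      ultimately show ?thesis by simp
    next
      case False
      hence "vec.span {A *v veronese3 s t} \<in> cubic_curve A" by (auto simp: cubic_curve_def)
      hence "\<forall>x\<in>vec.span {A *v veronese3 s t}. F x = 0" using sub by blast
      thus ?thesis by (simp add: quadratic_form_zero_on_span_iff[OF F(1)])
    qed
    note F0 = this
    have "\<exists>a. F (L *v a) \<noteq> 0"
    proof (rule ccontr)
      assume "\<nexists>a. F (L *v a) \<noteq> 0"
      hence U0: "F (A *v (veronese_comb s1 t1 s2 t2 s3 t3 *v x)) = 0" for x
        by (simp add: L U_def)
      have "F (A *v w) = 0" for w
        using quadratic_form_eq_0_if_zero_on_secant_plane[where F = "\<lambda>x. F (A *v x)",
            OF quadratic_form_comp[OF F(1)] F0 ne U0] .
      hence "F (A *v (B *v x)) = 0" for x .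
      thus False using F(2) by (simp add: BA)
    qed
    hence "conic_in_plane (plane_through p q r) K"
      unfolding H conic_in_plane_iff[OF injL]
      by (intro exI[of _ "\<lambda>a. F (L *v a)"] conjI quadratic_form_comp[OF F(1)])
         (assumption, rule K_def)
    moreover have "P \<in> K"
      if P: "P \<in> {p, q, r} \<union> (cubic_curve A \<inter> plane_through p q r)" for P
    proof -
      obtain a where a: "a \<noteq> 0" "P = vec.span {L *v a}"
        using pts[OF subsetD[OF six P]] by blast
      have "P \<in> cubic_curve A \<union> {p, q, r}" using P by blast
      hence "\<forall>x\<in>P. F x = 0" using subsetD[OF sub] by blast
      hence "F (L *v a) = 0" by (simp add: a(2) quadratic_form_zero_on_span_iff[OF F(1)])
      thus ?thesis unfolding K_def using a by blast
    qed
    ultimately show "\<exists>K. conic_in_plane (plane_through p q r) K \<and>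
        {p, q, r} \<union> (cubic_curve A \<inter> plane_through p q r) \<subseteq> K" by blast
  }
  assume "\<exists>K. conic_in_plane (plane_through p q r) K \<and>
       {p, q, r} \<union> (cubic_curve A \<inter> plane_through p q r) \<subseteq> K"
  then obtain F where F: "quadratic_form F" "\<exists>a. F a \<noteq> 0" and
    sub: "{p, q, r} \<union> (cubic_curve A \<inter> plane_through p q r) \<subseteq>
      {vec.span {L *v a} | a. a \<noteq> 0 \<and> F a = 0}"
    unfolding H conic_in_plane_iff[OF injL] by blast
  \<comment> \<open>Membership in the conic only provides some representative \<open>b\<close> with
    \<open>F b = 0\<close>; injectivity of \<open>L\<close> makes \<open>a\<close> a multiple of
    it.\<close>
  have on_conic: "F a = 0"
    if a: "a \<noteq> 0" and P: "vec.span {L *v a} \<in> {p, q, r} \<union> (cubic_curve A \<inter> plane_through p q r)"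
    for a
  proof -
    obtain b where b: "vec.span {L *v a} = vec.span {L *v b}" "F b = 0"
      using subsetD[OF sub P] by blast
    moreover have "L *v a \<noteq> 0" using a L0 by simp
    ultimately obtain c where "L *v a = c *s (L *v b)" by (auto simp: span_singleton_eq_iff)
    hence "L *v a = L *v (c *s b)" by (simp add: vector_scalar_commute)
    hence "a = c *s b" using injL by (auto dest: injD)
    thus ?thesis using b quadratic_form_scale[OF F(1)] by simp
  qed
  \<comment> \<open>The coordinate points correspond to the intersection points of curve and
    plane.\<close>
  have "F (axis i 1) = 0" for i :: 3
  proof (rule on_conic)
    have "L *v axis i 1 \<in> {A *v veronese3 s1 t1, A *v veronese3 s2 t2, A *v veronese3 s3 t3}"
      unfolding L U_def veronese_comb_mult using exhaust_3[of i] by (auto simp: axis_def)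
    thus "vec.span {L *v axis i 1} \<in> {p, q, r} \<union> (cubic_curve A \<inter> plane_through p q r)"
      unfolding inter by auto
  qed (simp add: axis_eq_0_iff)
  then obtain k1 k2 k3 where
    k: "\<And>x. F x = k1 * (x$2 * x$3) + k2 * (x$1 * x$3) + k3 * (x$1 * x$2)"
    using quadratic_form_3_zero_at_axes[OF F(1)] by blast
  obtain G where G: "quadratic_form G" "\<And>s t. G (veronese3 s t) = 0" "\<And>a. G (U *v a) = F a"
    using quadratic_form_extends_from_secant_plane[OF ne, of k1 k2 k3] unfolding U_def k by blast
  \<comment> \<open>\<open>G\<close> refers to the coordinates given by \<open>A\<close>; the
    inverse \<open>B\<close> transports it back to the original ones.\<close>
  define G' where "G' x = G (B *v x)" for x
  have G': "quadratic_form G'" unfolding G'_def by (rule quadratic_form_comp[OF G(1)])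
  have G'L: "G' (L *v a) = F a" for a by (simp add: G'_def L BA G)
  define Q where "Q = {p \<in> proj_space. \<forall>x\<in>p. G' x = 0}"
  have "quadric_surface Q"
    unfolding is_quadric_iff Q_def using G' G'L F(2) by metis
  moreover have "cubic_curve A \<subseteq> Q"
  proof -
    have "G' (A *v veronese3 s t) = 0" for s t by (simp add: G'_def BA G)
    hence "\<forall>x\<in>vec.span {A *v veronese3 s t}. G' x = 0" for s t
      by (simp only: quadratic_form_zero_on_span_iff[OF G'])
    thus ?thesis
      by (auto simp: cubic_curve_def Q_def invertible_mult_eq_0_iff[OF A])
  qed
  moreover have "P \<in> Q" if "P \<in> {p, q, r}" for P
  proof -
    from that have P: "P \<in> {p, q, r} \<union> (cubic_curve A \<inter> plane_through p q r)" by blast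
    obtain a where a: "a \<noteq> 0" "P = vec.span {L *v a}"
      using pts[OF subsetD[OF six P]] by blast
    moreover have "F a = 0" using on_conic[OF a(1)] P unfolding a(2) .
    ultimately show ?thesis
      by (simp add: Q_def L0 G'L quadratic_form_zero_on_span_iff[OF G'])
  qed
  ultimately show "\<exists>Q. quadric_surface Q \<and> cubic_curve A \<union> {p, q, r} \<subseteq> Q" by blast
qed

theorem proposition11:
  fixes C :: "(('a::alg_closed_field)^4) set set"
  assumes "twisted_cubic C"
  shows "zariski_open3 {(p, q, r). general_triple C p q r} \<and>
    {(p, q, r). general_triple C p q r} \<noteq> {} \<and>
    (\<forall>p q r. general_triple C p q r \<longrightarrow>
      ((\<exists>Q. quadric_surface Q \<and> C \<union> {p, q, r} \<subseteq> Q) \<longleftrightarrow>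
       (\<exists>x y z. distinct [p, q, r, x, y, z] \<and>
          C \<inter> plane_through p q r = {x, y, z} \<and>
          (\<exists>K. conic_in_plane (plane_through p q r) K \<and> {p, q, r, x, y, z} \<subseteq> K))))"
proof (intro conjI allI impI)
  obtain A where A: "invertible A" and C: "C = cubic_curve A"
    using assms unfolding twisted_cubic_def by blast
  show "zariski_open3 {(p, q, r). general_triple C p q r}"
    unfolding C by (rule zariski_open3_general_triple[OF A])
  show "{(p, q, r). general_triple C p q r} \<noteq> {}"
    unfolding C using general_triple_exists[OF A] by blast
  fix p q r assume gen: "general_triple C p q r"
  \<comment> \<open>Any admissible \<open>x\<close>, \<open>y\<close>, \<open>z\<close> make up the
    whole intersection of curve and plane, so the conic condition is that of
    \<open>quadric_iff_conic\<close>; this step provides such points.\<close>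
  obtain x y z where "distinct [p, q, r, x, y, z]" "C \<inter> plane_through p q r = {x, y, z}"
    using general_triple_secant_plane[OF A gen[unfolded C]] unfolding C by metis
  moreover have "{p, q, r, x, y, z} = {p, q, r} \<union> {x, y, z}" for x y z by blast
  ultimately show "(\<exists>Q. quadric_surface Q \<and> C \<union> {p, q, r} \<subseteq> Q) \<longleftrightarrow>
       (\<exists>x y z. distinct [p, q, r, x, y, z] \<and>
          C \<inter> plane_through p q r = {x, y, z} \<and>
          (\<exists>K. conic_in_plane (plane_through p q r) K \<and> {p, q, r, x, y, z} \<subseteq> K))"
    using quadric_iff_conic[OF A gen[unfolded C], folded C] by metis
qed

end
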